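(* Let $u$ be any permutation, let $k$ be a positive integer such that $u_i<u_{i+1}$ for every $i>k$, and let $\lambda$ be any partition of length at most $k$, of size $n=|\lambda|$. For a permutation $w$, let $c^{w}_{u,v(\lambda,k)}$ be the coefficient of $\mathfrak{S}_w$ in the Schubert basis expansion of $\mathfrak{S}_u\cdot\mathfrak{S}_{v(\lambda,k)}$. Then for every permutation $w$, $c^{w}_{u,v(\lambda,k)}$ is the cardinality of a subset of the set of paths $$w=u\,(a_1,b_1)\cdots(a_n,b_n)\quad\text{with } a_i\le k<b_i \text{ for all } i \text{ and } \ell(w)=\ell(u)+n.$$
   Context: Permutations are bijections $w$ of $\{1,2,3,\ldots\}$ fixing all but finitely many elements, written in one-line notation $w=w_1w_2\cdots$; $\ell(w)$ is the number of inversions. $w(a,b)$ denotes the permutation obtained from $w$ by exchanging the entries in positions $a$ and $b$; products of several transpositions are applied in this way from left to right. A path $w=u(a_1,b_1)\cdots(a_n,b_n)$ is recorded as the sequence $((a_1,b_1),\ldots,(a_n,b_n))$ of pairs of positive integers. Grassmannian permutation: for a partition $\lambda$ of length at most $k$ (with $\lambda_i=0$ for $i$ larger than the length), $v(\lambda,k)$ is the permutation with $v(\lambda,k)_i=i+\lambda_{k-i+1}$ for $i=1,\ldots,k$ and with the remaining positive integers in increasing order in positions $k+1,k+2,\ldots$; thus it has no descent except possibly at $k$. Schubert polynomial: a reduced expression for $w$ is a sequence $\rho=(i_p,\ldots,i_1)$ of positive integers with $p=\ell(w)$ such that, starting from the one-line notation of the identity and successively exchanging the entries in positions $i_1,i_1+1$,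 then in positions $i_2,i_2+1$, and so on up to positions $i_p,i_p+1$, one obtains $w$. Write $\rho_j=i_j$, and let $R(w)$ be the set of reduced expressions for $w$. A sequence $\alpha=(\alpha_1,\ldots,\alpha_{\ell(w)})$ of positive integers is $\rho$-compatible if $\alpha$ is weakly increasing, $\alpha_j<\alpha_{j+1}$ whenever $\rho_j<\rho_{j+1}$, and $\alpha_j\le\rho_j$ for all $j$. Then $\mathfrak{S}_w=\sum_{\rho\in R(w)}\sum_{\alpha\ \rho\text{-compatible}}x_{\alpha_1}\cdots x_{\alpha_{\ell(w)}}$. The Schubert polynomials form a $\mathbb{Z}$-basis of $\mathbb{Z}[x_1,x_2,\ldots]$, and $c_{u,v}^w$ is defined by $\mathfrak{S}_u\mathfrak{S}_v=\sum_w c_{u,v}^w\mathfrak{S}_w$. *)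

theory Defs
  imports Complex_Main "HOL-Library.Poly_Mapping" "HOL-Library.Infinite_Set"
    "HOL-Combinatorics.Combinatorics"
begin

text \<open>Permutations of the positive integers are functions on \<open>nat\<close> fixing the
  extra point \<open>0\<close>; the one-line notation of \<open>w\<close> is \<open>w 1, w 2, w 3, \<dots>\<close>.\<close>

definition is_perm :: "(nat \<Rightarrow> nat) \<Rightarrow> bool" where
  "is_perm w \<longleftrightarrow> w permutes {1..} \<and> finite {i. w i \<noteq> i}"

definition perm_length :: "(nat \<Rightarrow> nat) \<Rightarrow> nat" where
  "perm_length w = card {(i, j). 1 \<le> i \<and> i < j \<and> w j < w i}"

text \<open>Composition on the right with a transposition exchanges the entries in the two
  \<^emph>\<open>positions\<close>; a list of pairs is applied from left to right.\<close>

definition swap_positions :: "(nat \<Rightarrow> nat) \<Rightarrow> nat \<times> nat \<Rightarrow> nat \<Rightarrow> nat" where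
  "swap_positions w p = w \<circ> Transposition.transpose (fst p) (snd p)"

definition apply_path :: "(nat \<Rightarrow> nat) \<Rightarrow> (nat \<times> nat) list \<Rightarrow> nat \<Rightarrow> nat" where
  "apply_path u ps = foldl swap_positions u ps"

definition paths :: "nat \<Rightarrow> nat \<Rightarrow> (nat \<Rightarrow> nat) \<Rightarrow> (nat \<Rightarrow> nat) \<Rightarrow> (nat \<times> nat) list set" where
  "paths k n u w =
     {ps. length ps = n \<and> (\<forall>(a, b) \<in> set ps. 1 \<le> a \<and> a \<le> k \<and> k < b) \<and>
          w = apply_path u ps \<and> perm_length w = perm_length u + n}"

text \<open>A partition is the weakly decreasing list of its positive parts.\<close>

definition is_partition :: "nat list \<Rightarrow> bool" where
  "is_partition lam \<longleftrightarrow> sorted_wrt (\<ge>) lam \<and> 0 \<notin> set lam"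

definition part :: "nat list \<Rightarrow> nat \<Rightarrow> nat" where
  "part lam i = (if 1 \<le> i \<and> i \<le> length lam then lam ! (i - 1) else 0)"

text \<open>\<open>enumerate S\<close> lists the infinite set \<open>S\<close> increasingly, with indices starting at \<open>0\<close>.\<close>

definition grassmannian :: "nat list \<Rightarrow> nat \<Rightarrow> nat \<Rightarrow> nat" where
  "grassmannian lam k i =
     (if i = 0 then 0
      else if i \<le> k then i + part lam (k - i + 1)
      else enumerate ({1..} - (\<lambda>j. j + part lam (k - j + 1)) ` {1..k}) (i - k - 1))"

text \<open>A reduced expression \<open>(i\<^sub>p, \<dots>, i\<^sub>1)\<close> is stored as the list \<open>[i\<^sub>1, \<dots>, i\<^sub>p]\<close>,
  that is, in the order in which the exchanges are carried out; hence
  \<open>\<rho>\<^sub>j = i\<^sub>j\<close> is the list entry \<open>\<rho> ! (j - 1)\<close>.\<close>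

definition reduced_expressions :: "(nat \<Rightarrow> nat) \<Rightarrow> nat list set" where
  "reduced_expressions w =
     {\<rho>. length \<rho> = perm_length w \<and> (\<forall>i \<in> set \<rho>. 1 \<le> i) \<and>
         apply_path id (map (\<lambda>i. (i, i + 1)) \<rho>) = w}"

definition compatible_seqs :: "nat list \<Rightarrow> nat list set" where
  "compatible_seqs \<rho> =
     {\<alpha>. length \<alpha> = length \<rho> \<and> (\<forall>a \<in> set \<alpha>. 1 \<le> a) \<and> sorted \<alpha> \<and>
         (\<forall>j. Suc j < length \<rho> \<longrightarrow> \<rho> ! j < \<rho> ! Suc j \<longrightarrow> \<alpha> ! j < \<alpha> ! Suc j) \<and>
         (\<forall>j < length \<rho>. \<alpha> ! j \<le> \<rho> ! j)}"

text \<open>Integer polynomials in the variables \<open>x\<^sub>i\<close>: finitely supported functions from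
  exponent vectors to coefficients. The variable \<open>x\<^sub>0\<close> is never used.\<close>

type_synonym ipoly = "(nat \<Rightarrow>\<^sub>0 nat) \<Rightarrow>\<^sub>0 int"

definition X :: "nat \<Rightarrow> ipoly" where
  "X i = Poly_Mapping.single (Poly_Mapping.single i 1) 1"

definition schubert :: "(nat \<Rightarrow> nat) \<Rightarrow> ipoly" where
  "schubert w =
     (\<Sum>\<rho> \<in> reduced_expressions w. \<Sum>\<alpha> \<in> compatible_seqs \<rho>. prod_list (map X \<alpha>))"

text \<open>The description determines the coefficient function because the Schubert
  polynomials form a basis of the ring of polynomials in \<open>x\<^sub>1, x\<^sub>2, \<dots>\<close>.\<close>

definition schubert_coeff :: "(nat \<Rightarrow> nat) \<Rightarrow> (nat \<Rightarrow> nat) \<Rightarrow> (nat \<Rightarrow> nat) \<Rightarrow> int" where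
  "schubert_coeff u v =
     (THE c. finite {w. c w \<noteq> 0} \<and> (\<forall>w. c w \<noteq> 0 \<longrightarrow> is_perm w) \<and>
             schubert u * schubert v = (\<Sum>w \<in> {w. c w \<noteq> 0}. of_int (c w) * schubert w))"

end

theory Submission
  imports Defs
begin

text \<open>Write \<open>M\<close> for \<open>x\<^sub>1 + \<dots> + x\<^sub>k\<close>, \<open>S w\<close> for the Schubert polynomial of \<open>w\<close>, and \<open>v\<close> for
  the Grassmannian permutation, of length \<open>n\<close>. Call a polynomial positive if it is a combination
  of Schubert polynomials with nonnegative integer coefficients.

  By Monk's formula, \<open>M * S u\<close> is the sum of the \<open>S (u(a, b))\<close> over the upward Bruhat covers
  \<open>u(a, b)\<close> with \<open>a \<le> k < b\<close>. So the coefficient of \<open>S w\<close> in \<open>M\<^sup>n * S u\<close> is the number of paths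
  from \<open>u\<close> to \<open>w\<close> that consist of \<open>n\<close> such covers, and all these paths are among the allowed ones.
  It is therefore enough that both \<open>S u * S v\<close> and \<open>M\<^sup>n * S u - S u * S v\<close> are positive: the
  coefficient in question then lies between \<open>0\<close> and the number of those paths.

  Both statements follow from one: \<open>S u * S v'\<close> is positive whenever \<open>u\<close> has no descent after \<open>k\<close> and
  \<open>v'\<close> has no descent outside \<open>k\<close> (\<open>schubert_positive_product\<close>). The first statement is the case
  \<open>v' = v\<close>. For the second, reach \<open>v\<close> from the identity by covers through permutations of the same
  kind; by Monk's formula each step produces the wanted Schubert polynomial and further ones that belong
  to permutations of the same kind, and these only contribute positive terms
  (\<open>schubert_positive_power_minus_product\<close>).

  To prove that \<open>S u * S v'\<close> is positive, use divided differences. They map \<open>S w\<close> to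
  \<open>S (w s\<^sub>i)\<close> if \<open>i\<close> is a descent of \<open>w\<close> and to \<open>0\<close> otherwise (\<open>ddiff_schubert\<close>), so they preserve
  positivity. Since \<open>S v'\<close> is symmetric in \<open>x\<^sub>1, \<dots>, x\<^sub>k\<close>, the divided differences with \<open>i < k\<close> do
  not act on it, and one may replace \<open>u\<close> by \<open>u s\<^sub>i\<close> whenever \<open>i < k\<close> is an ascent of \<open>u\<close>. This reduces
  the claim to the case that the first \<open>k\<close> entries of \<open>u\<close> decrease. Then \<open>S u\<close> is a monomial with
  weakly decreasing exponents (\<open>schubert_descending\<close>), hence a product of monomials \<open>x\<^sub>1 \<cdots> x\<^sub>j\<close>, and
  multiplication by \<open>x\<^sub>1 \<cdots> x\<^sub>j\<close> preserves positivity. The last fact is the heart of the proof: the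
  coefficient of \<open>S z\<close> is found by applying divided differences along a reduced word of \<open>z\<close>, and if the
  first descent of \<open>z\<close> is removed in every step, then the Leibniz rule never produces a minus sign
  (\<open>squarefree_monomial_coeff_nonneg\<close>).

  The rule for divided differences of Schubert polynomials comes from the theorem of Fomin and Stanley:
  the sum over reduced words and compatible sequences is a coefficient of a product in the nilCoxeter
  algebra, and the factors of that product satisfy a commutation relation. Monk's formula and the linear independence of
  the Schubert polynomials are consequences of that rule.\<close>

section \<open>Divided differences of polynomials\<close>

text \<open>The simple transposition \<open>s\<^sub>i\<close> acts on exponent vectors and, through them, on polynomials.\<close>

definition swap_exponents :: "nat \<Rightarrow> (nat \<Rightarrow>\<^sub>0 nat) \<Rightarrow> (nat \<Rightarrow>\<^sub>0 nat)" where
  "swap_exponents i m = Poly_Mapping.map_key (Transposition.transpose i (Suc i)) m"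

definition swap_vars :: "nat \<Rightarrow> ipoly \<Rightarrow> ipoly" where
  "swap_vars i f = Poly_Mapping.map_key (swap_exponents i) f"

lemma inj_transpose: "inj (Transposition.transpose a b)"
  by (simp add: bij_is_inj)

lemma lookup_swap_exponents:
  "Poly_Mapping.lookup (swap_exponents i m) j = Poly_Mapping.lookup m (Transposition.transpose i (Suc i) j)"
  unfolding swap_exponents_def by (simp add: Poly_Mapping.map_key.rep_eq[OF inj_transpose])

lemma swap_exponents_involutory [simp]: "swap_exponents i (swap_exponents i m) = m"
  by (rule poly_mapping_eqI) (simp add: lookup_swap_exponents)

lemma inj_swap_exponents: "inj (swap_exponents i)"
  by (metis injI swap_exponents_involutory)

lemma swap_exponents_add: "swap_exponents i (m + n) = swap_exponents i m + swap_exponents i n"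
  by (rule poly_mapping_eqI) (simp add: lookup_swap_exponents lookup_add)

lemma swap_exponents_zero [simp]: "swap_exponents i 0 = 0"
  by (rule poly_mapping_eqI) (simp add: lookup_swap_exponents)

lemma lookup_swap_vars:
  "Poly_Mapping.lookup (swap_vars i f) m = Poly_Mapping.lookup f (swap_exponents i m)"
  unfolding swap_vars_def by (simp add: Poly_Mapping.map_key.rep_eq[OF inj_swap_exponents])

lemma swap_vars_diff: "swap_vars i (f - g) = swap_vars i f - swap_vars i g"
  by (rule poly_mapping_eqI) (simp add: lookup_swap_vars lookup_minus)

lemma swap_vars_add: "swap_vars i (f + g) = swap_vars i f + swap_vars i g"
  by (rule poly_mapping_eqI) (simp add: lookup_swap_vars lookup_add)

lemma swap_vars_zero [simp]: "swap_vars i 0 = 0"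
  by (rule poly_mapping_eqI) (simp add: lookup_swap_vars)

lemma swap_vars_single:
  "swap_vars i (Poly_Mapping.single m c) = Poly_Mapping.single (swap_exponents i m) c"
proof -
  have "m = swap_exponents i n \<longleftrightarrow> swap_exponents i m = n" for n
    by (metis swap_exponents_involutory)
  then show ?thesis
    by (intro poly_mapping_eqI) (simp add: lookup_swap_vars lookup_single when_def)
qed

lemma swap_vars_single_mult:
  "swap_vars i (Poly_Mapping.single m c * g) = swap_vars i (Poly_Mapping.single m c) * swap_vars i g"
  by (rule frag_induction[of g UNIV])
     (simp_all add: mult_single swap_vars_single swap_exponents_add right_diff_distrib swap_vars_diff)

lemma swap_vars_mult: "swap_vars i (f * g) = swap_vars i f * swap_vars i g"
  by (rule frag_induction[of f UNIV])
     (simp_all add: swap_vars_single_mult left_diff_distrib swap_vars_diff)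

lemma swap_vars_one [simp]: "swap_vars i 1 = 1"
  using swap_vars_single[of i 0 1] by simp

lemma of_int_single: "(of_int c :: ipoly) = Poly_Mapping.single 0 c"
  by (simp flip: single_of_int)

lemma swap_vars_of_int [simp]: "swap_vars i (of_int c) = of_int c"
  unfolding of_int_single by (simp add: swap_vars_single)

lemma swap_vars_X: "swap_vars i (X j) = X (Transposition.transpose i (Suc i) j)"
proof -
  have "swap_exponents i (Poly_Mapping.single j 1)
      = Poly_Mapping.single (Transposition.transpose i (Suc i) j) 1"
    by (rule poly_mapping_eqI)
       (auto simp: lookup_single lookup_swap_exponents when_def transpose_def)
  then show ?thesis by (simp add: X_def swap_vars_single)
qed

text \<open>Constants need no case of their own: they are obtained from \<open>1\<close> by subtraction.\<close>

lemma ipoly_induct: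
  fixes P :: "ipoly \<Rightarrow> bool"
  assumes one: "P 1" and diff: "\<And>f g. P f \<Longrightarrow> P g \<Longrightarrow> P (f - g)"
    and X: "\<And>i. P (X i)" and mult: "\<And>f g. P f \<Longrightarrow> P g \<Longrightarrow> P (f * g)"
  shows "P f"
proof -
  have P0: "P 0" using diff[OF one one] by simp
  have var: "P (Poly_Mapping.single (Poly_Mapping.single i n) 1)" for i n
  proof (induction n)
    case 0
    then show ?case using one by simp
  next
    case (Suc n)
    have "Poly_Mapping.single (Poly_Mapping.single i (Suc n)) 1
        = X i * Poly_Mapping.single (Poly_Mapping.single i n) (1::int)"
      by (simp add: X_def mult_single single_add[symmetric])
    then show ?case using mult[OF X Suc] by simp
  qed
  have mono: "P (Poly_Mapping.single m 1)" for m
  proof (induction m rule: update_induct)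
    case const
    then show ?case using one by simp
  next
    case (update m a b)
    have "Poly_Mapping.update a b m = m + Poly_Mapping.single a b"
      using update by (intro poly_mapping_eqI)
        (auto simp: lookup_update lookup_add lookup_single when_def in_keys_iff)
    then show ?case using mult[OF update(3) var] by (simp add: mult_single)
  qed
  show ?thesis
    by (rule frag_induction[of f UNIV]) (auto intro: P0 mono diff)
qed

lemma X_inject [simp]: "X i = X j \<longleftrightarrow> i = j"
proof
  assume "X i = X j"
  then have "Poly_Mapping.keys (X i) = Poly_Mapping.keys (X j)" by simp
  then have "Poly_Mapping.single i (1::nat) = Poly_Mapping.single j 1" by (simp add: X_def)
  then have "Poly_Mapping.keys (Poly_Mapping.single i (1::nat)) = Poly_Mapping.keys (Poly_Mapping.single j (1::nat))" by simp
  then show "i = j" by simp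
qed simp

definition ddiff :: "nat \<Rightarrow> ipoly \<Rightarrow> ipoly" where
  "ddiff i f = (THE g. (X i - X (Suc i)) * g = f - swap_vars i f)"

lemma ddiff_unique:
  assumes "(X i - X (Suc i)) * g = f - swap_vars i f"
  shows "ddiff i f = g"
  unfolding ddiff_def
proof (rule the_equality)
  fix h assume "(X i - X (Suc i)) * h = f - swap_vars i f"
  then have "(X i - X (Suc i)) * h = (X i - X (Suc i)) * g" using assms by simp
  then show "h = g" by simp
qed (rule assms)

text \<open>The quotient exists because it does so for the variables, and the set of polynomials for
  which it exists is closed under subtraction and, by the Leibniz rule, under products.\<close>

lemma ddiff: "(X i - X (Suc i)) * ddiff i f = f - swap_vars i f"
proof -
  have "\<exists>g. (X i - X (Suc i)) * g = f - swap_vars i f"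
  proof (induction f rule: ipoly_induct)
    case 1
    show ?case by (rule exI[of _ 0]) simp
  next
    case (2 f g)
    then obtain f' g' where "(X i - X (Suc i)) * f' = f - swap_vars i f"
      "(X i - X (Suc i)) * g' = g - swap_vars i g" by blast
    then show ?case
      by (intro exI[of _ "f' - g'"]) (simp only: swap_vars_diff right_diff_distrib[of _ f' g'], simp)
  next
    case (3 j)
    consider "j = i" | "j = Suc i" | "j \<noteq> i" "j \<noteq> Suc i" by blast
    then show ?case
    proof cases
      case 1
      then show ?thesis by (intro exI[of _ 1]) (simp add: swap_vars_X)
    next
      case 2
      then show ?thesis by (intro exI[of _ "-1"]) (simp add: swap_vars_X)
    next
      case 3
      then show ?thesis by (intro exI[of _ 0]) (simp add: swap_vars_X transpose_apply_other)
    qed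
  next
    case (4 f g)
    then obtain f' g' where f': "(X i - X (Suc i)) * f' = f - swap_vars i f"
      and g': "(X i - X (Suc i)) * g' = g - swap_vars i g" by blast
    have "(X i - X (Suc i)) * (f' * g + swap_vars i f * g')
        = ((X i - X (Suc i)) * f') * g + swap_vars i f * ((X i - X (Suc i)) * g')"
      by (simp add: algebra_simps)
    also have "\<dots> = f * g - swap_vars i (f * g)"
      unfolding f' g' swap_vars_mult by (simp add: algebra_simps)
    finally show ?case by blast
  qed
  then show ?thesis using ddiff_unique by metis
qed

lemma ddiff_add: "ddiff i (f + g) = ddiff i f + ddiff i g"
  by (rule ddiff_unique) (simp add: distrib_left ddiff swap_vars_add)

lemma ddiff_diff: "ddiff i (f - g) = ddiff i f - ddiff i g"
  by (rule ddiff_unique) (simp add: right_diff_distrib ddiff swap_vars_diff)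

lemma ddiff_mult: "ddiff i (f * g) = ddiff i f * g + swap_vars i f * ddiff i g"
proof (rule ddiff_unique)
  have "(X i - X (Suc i)) * (ddiff i f * g + swap_vars i f * ddiff i g)
      = ((X i - X (Suc i)) * ddiff i f) * g + swap_vars i f * ((X i - X (Suc i)) * ddiff i g)"
    by (simp add: algebra_simps)
  also have "\<dots> = f * g - swap_vars i (f * g)"
    unfolding ddiff swap_vars_mult by (simp add: algebra_simps)
  finally show "(X i - X (Suc i)) * (ddiff i f * g + swap_vars i f * ddiff i g)
    = f * g - swap_vars i (f * g)" .
qed

lemma ddiff_symmetric: "swap_vars i f = f \<Longrightarrow> ddiff i f = 0"
  by (rule ddiff_unique) simp

lemma ddiff_eq_0_iff: "ddiff i f = 0 \<longleftrightarrow> swap_vars i f = f"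
  using ddiff[of i f] ddiff_symmetric by auto

lemma ddiff_zero [simp]: "ddiff i 0 = 0"
  by (simp add: ddiff_symmetric)

lemma ddiff_of_int [simp]: "ddiff i (of_int c) = 0"
  by (simp add: ddiff_symmetric)

lemma ddiff_sum: "ddiff i (\<Sum>a\<in>A. f a) = (\<Sum>a\<in>A. ddiff i (f a))"
  by (induction A rule: infinite_finite_induct) (simp_all add: ddiff_add)

lemma swap_vars_prod: "swap_vars i (\<Prod>a\<in>A. f a) = (\<Prod>a\<in>A. swap_vars i (f a))"
  by (induction A rule: infinite_finite_induct) (simp_all add: swap_vars_mult)

lemma ddiff_X: "ddiff i (X j) = (if j = i then 1 else if j = Suc i then - 1 else 0)"
  by (rule ddiff_unique) (auto simp: swap_vars_X transpose_apply_other)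

definition const_term :: "ipoly \<Rightarrow> int" where
  "const_term f = Poly_Mapping.lookup f 0"

lemma const_term_add: "const_term (f + g) = const_term f + const_term g"
  by (simp add: const_term_def lookup_add)
lemma const_term_diff: "const_term (f - g) = const_term f - const_term g"
  by (simp add: const_term_def lookup_minus)
lemma const_term_zero [simp]: "const_term 0 = 0"
  by (simp add: const_term_def)
lemma const_term_of_int [simp]: "const_term (of_int c) = c"
  by (simp add: const_term_def of_int_single)
lemma const_term_one [simp]: "const_term 1 = 1"
  by (simp add: const_term_def)
lemma const_term_sum: "const_term (\<Sum>a\<in>A. f a) = (\<Sum>a\<in>A. const_term (f a))"
  by (induction A rule: infinite_finite_induct) (simp_all add: const_term_add)
lemma const_term_X [simp]: "const_term (X i) = 0"
proof -
  have "Poly_Mapping.single i (1::nat) \<noteq> 0" by (metis lookup_single_eq lookup_zero zero_neq_one)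
  then show ?thesis by (simp add: const_term_def X_def lookup_single)
qed

lemma const_term_mult: "const_term (f * g) = const_term f * const_term g"
proof -
  have add0: "m + n = 0 \<longleftrightarrow> m = 0 \<and> n = 0" for m n :: "nat \<Rightarrow>\<^sub>0 nat"
    by (auto simp: poly_mapping_eq_iff lookup_add fun_eq_iff)
  have *: "const_term (Poly_Mapping.single m c * Poly_Mapping.single n d)
      = const_term (Poly_Mapping.single m c) * const_term (Poly_Mapping.single n d)" for m n c d
    using add0[of m n] by (auto simp: const_term_def mult_single lookup_single when_def)
  have **: "const_term (Poly_Mapping.single m c * g) = const_term (Poly_Mapping.single m c) * const_term g" for m c g
    by (rule frag_induction[of g UNIV]) (simp_all add: * right_diff_distrib const_term_diff)
  show ?thesis
    by (rule frag_induction[of f UNIV]) (simp_all add: ** left_diff_distrib const_term_diff)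
qed

text \<open>Polynomials free of the variable \<open>X 0\<close>, on which no \<open>s\<^sub>i\<close> with \<open>i \<ge> 1\<close> acts.\<close>

definition positive_vars :: "ipoly \<Rightarrow> bool" where
  "positive_vars f \<longleftrightarrow> (\<forall>m \<in> Poly_Mapping.keys f. Poly_Mapping.lookup m 0 = 0)"

lemma positive_vars_add: "positive_vars f \<Longrightarrow> positive_vars g \<Longrightarrow> positive_vars (f + g)"
  unfolding positive_vars_def using Poly_Mapping.keys_add[of f g] by blast
lemma positive_vars_diff: "positive_vars f \<Longrightarrow> positive_vars g \<Longrightarrow> positive_vars (f - g)"
  unfolding positive_vars_def using keys_diff[of f g] by blast
lemma positive_vars_mult: "positive_vars f \<Longrightarrow> positive_vars g \<Longrightarrow> positive_vars (f * g)"
  unfolding positive_vars_def using keys_mult[of f g] by (fastforce simp: lookup_add)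
lemma positive_vars_zero [simp]: "positive_vars 0" by (simp add: positive_vars_def)
lemma positive_vars_one [simp]: "positive_vars 1" by (simp add: positive_vars_def)
lemma positive_vars_X: "1 \<le> i \<Longrightarrow> positive_vars (X i)"
  by (simp add: positive_vars_def X_def lookup_single when_def)
lemma positive_vars_sum: "(\<And>a. a \<in> A \<Longrightarrow> positive_vars (f a)) \<Longrightarrow> positive_vars (\<Sum>a\<in>A. f a)"
  by (induction A rule: infinite_finite_induct) (simp_all add: positive_vars_add)
lemma positive_vars_prod_list: "(\<And>f. f \<in> set fs \<Longrightarrow> positive_vars f) \<Longrightarrow> positive_vars (prod_list fs)"
  by (induction fs) (simp_all add: positive_vars_mult)

text \<open>A polynomial with this much symmetry is constant: the largest variable that occurs in it could
  otherwise be exchanged with the next one. Identities between Schubert polynomials are proved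
  below by comparing constant terms and all divided differences.\<close>

lemma symmetric_imp_zero:
  assumes pos: "positive_vars f" and const: "const_term f = 0"
    and sym: "\<And>i. 1 \<le> i \<Longrightarrow> ddiff i f = 0"
  shows "f = 0"
proof (rule ccontr)
  assume "f \<noteq> 0"
  define K where "K = (\<Union>m \<in> Poly_Mapping.keys f. Poly_Mapping.keys m)"
  have fin: "finite K" by (simp add: K_def)
  obtain m where m: "m \<in> Poly_Mapping.keys f" using \<open>f \<noteq> 0\<close> by (metis all_not_in_conv keys_eq_empty)
  then have "m \<noteq> 0" using const by (auto simp: const_term_def in_keys_iff)
  then obtain a where "a \<in> Poly_Mapping.keys m"
    by (metis in_keys_iff lookup_zero poly_mapping_eqI)
  then have "K \<noteq> {}" using m unfolding K_def by blast
  then have "Max K \<in> K" using fin by simp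
  then obtain n where n: "n \<in> Poly_Mapping.keys f" "Max K \<in> Poly_Mapping.keys n" by (auto simp: K_def)
  then have "1 \<le> Max K" using pos
    by (metis One_nat_def Suc_leI bot_nat_0.not_eq_extremum in_keys_iff positive_vars_def)
  then have "swap_vars (Max K) f = f" using sym ddiff_eq_0_iff by blast
  then have "swap_exponents (Max K) n \<in> Poly_Mapping.keys f"
    using n(1) by (metis in_keys_iff lookup_swap_vars)
  moreover have "Suc (Max K) \<in> Poly_Mapping.keys (swap_exponents (Max K) n)"
    using n(2) by (simp add: in_keys_iff lookup_swap_exponents)
  ultimately have "Suc (Max K) \<in> K" by (auto simp: K_def)
  then have "Suc (Max K) \<le> Max K" using fin by simp
  then show False by simp
qed

section \<open>Permutations and their lengths\<close>

abbreviation swap_adjacent :: "(nat \<Rightarrow> nat) \<Rightarrow> nat \<Rightarrow> nat \<Rightarrow> nat" where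
  "swap_adjacent w i \<equiv> swap_positions w (i, Suc i)"

lemma swap_positions_apply [simp]:
  "swap_positions w (a, b) c = w (Transposition.transpose a b c)"
  by (simp add: swap_positions_def)

lemma swap_positions_involutory [simp]: "swap_positions (swap_positions w (a, b)) (a, b) = w"
  by (simp add: fun_eq_iff)

lemma swap_adjacent_inject: "swap_adjacent v i = swap_adjacent w i \<longleftrightarrow> v = w"
  by (metis swap_positions_involutory)

lemma is_perm_inj: "is_perm w \<Longrightarrow> inj w"
  unfolding is_perm_def by (meson permutes_inj)

lemma is_perm_eq_iff: "is_perm w \<Longrightarrow> w i = w j \<longleftrightarrow> i = j"
  using is_perm_inj by (simp add: inj_eq)

lemma is_perm_zero [simp]: "is_perm w \<Longrightarrow> w 0 = 0"
  unfolding is_perm_def permutes_def by auto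

lemma is_perm_pos: "is_perm w \<Longrightarrow> 1 \<le> i \<Longrightarrow> 1 \<le> w i"
  by (metis is_perm_eq_iff is_perm_zero less_one linorder_not_less)

lemma is_perm_id [simp]: "is_perm id"
  by (simp add: is_perm_def permutes_id)

lemma is_perm_swap_positions:
  assumes "is_perm w" "1 \<le> a" "1 \<le> b"
  shows "is_perm (swap_positions w (a, b))"
proof -
  have "Transposition.transpose a b permutes {1..}" using assms by (simp add: permutes_swap_id)
  moreover have "{i. (swap_positions w (a, b)) i \<noteq> i} \<subseteq> {i. w i \<noteq> i} \<union> {a, b}"
    by (auto simp: transpose_def)
  ultimately show ?thesis using assms unfolding is_perm_def swap_positions_def fst_conv snd_conv
    by (meson finite.emptyI finite_UnI finite_insert finite_subset permutes_compose)
qed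

definition fixes_above :: "nat \<Rightarrow> (nat \<Rightarrow> nat) \<Rightarrow> bool" where
  "fixes_above N w \<longleftrightarrow> (\<forall>i>N. w i = i)"

lemma is_perm_fixes_above: "is_perm w \<Longrightarrow> \<exists>N. fixes_above N w"
  unfolding is_perm_def fixes_above_def
  by (metis (mono_tags, lifting) finite_nat_set_iff_bounded_le linorder_not_less mem_Collect_eq)

lemma fixes_above_mono: "fixes_above N w \<Longrightarrow> N \<le> M \<Longrightarrow> fixes_above M w"
  by (simp add: fixes_above_def)

lemma fixes_above_le: "is_perm w \<Longrightarrow> fixes_above N w \<Longrightarrow> i \<le> N \<Longrightarrow> w i \<le> N"
  by (metis fixes_above_def is_perm_eq_iff linorder_not_less)

lemma fixes_above_transpose:
  "fixes_above N w \<Longrightarrow> a \<le> N \<Longrightarrow> b \<le> N \<Longrightarrow> fixes_above N (swap_positions w (a, b))"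
  by (simp add: fixes_above_def transpose_def)

definition inversions :: "(nat \<Rightarrow> nat) \<Rightarrow> (nat \<times> nat) set" where
  "inversions w = {(i, j). 1 \<le> i \<and> i < j \<and> w j < w i}"

lemma perm_length_inversions: "perm_length w = card (inversions w)"
  by (simp add: perm_length_def inversions_def)

lemma finite_inversions:
  assumes "is_perm w" shows "finite (inversions w)"
proof -
  obtain N where N: "fixes_above N w" using is_perm_fixes_above assms by blast
  have "inversions w \<subseteq> {..N} \<times> {..N}"
  proof (clarsimp simp: inversions_def)
    fix i j assume ij: "Suc 0 \<le> i" "i < j" "w j < w i"
    have "j \<le> N"
    proof (rule ccontr)
      assume "\<not> j \<le> N"
      then have "w j = j" using N by (simp add: fixes_above_def)
      moreover have "w i \<le> j"
        using N \<open>\<not> j \<le> N\<close> \<open>i < j\<close> fixes_above_le[OF assms N, of i]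
        by (cases "i \<le> N") (auto simp: fixes_above_def)
      ultimately show False using ij by simp
    qed
    then show "i \<le> N \<and> j \<le> N" using ij by simp
  qed
  then show ?thesis by (rule finite_subset) simp
qed

text \<open>At an ascent \<open>i\<close>, the inversions of \<open>w s\<^sub>i\<close> are those of \<open>w\<close>, carried along by \<open>s\<^sub>i\<close>, together with \<open>(i, i + 1)\<close>.\<close>

lemma perm_length_swap_ascent:
  assumes w: "is_perm w" and i: "1 \<le> i" and asc: "w i < w (Suc i)"
  shows "perm_length (swap_adjacent w i) = Suc (perm_length w)"
proof -
  let ?s = "Transposition.transpose i (Suc i)"
  let ?f = "\<lambda>(a, b). (?s a, ?s b)"
  have s1: "1 \<le> a \<longleftrightarrow> 1 \<le> ?s a" for a using i by (auto simp: transpose_def)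
  have s2: "a < b \<Longrightarrow> (a, b) \<noteq> (i, Suc i) \<Longrightarrow> ?s a < ?s b" for a b by (auto simp: transpose_def)
  have eq: "inversions (swap_adjacent w i) = insert (i, Suc i) (?f ` inversions w)"
  proof (intro equalityI subsetI)
    fix p assume p: "p \<in> inversions (swap_adjacent w i)"
    obtain a b where ab: "p = (a, b)" by fastforce
    show "p \<in> insert (i, Suc i) (?f ` inversions w)"
    proof (cases "(a, b) = (i, Suc i)")
      case False
      then have "(?s a, ?s b) \<in> inversions w"
        using p s1[of a] s2[of a b] by (auto simp: ab inversions_def)
      then have "?f (?s a, ?s b) \<in> ?f ` inversions w" by (rule imageI)
      then show ?thesis by (simp add: ab)
    qed (simp add: ab)
  next
    fix p assume "p \<in> insert (i, Suc i) (?f ` inversions w)"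
    then consider "p = (i, Suc i)" | a b where "p = (?s a, ?s b)" "(a, b) \<in> inversions w" by auto
    then show "p \<in> inversions (swap_adjacent w i)"
    proof cases
      case 1
      then show ?thesis using asc i by (simp add: inversions_def)
    next
      case (2 a b)
      then have "(a, b) \<noteq> (i, Suc i)" using asc by (auto simp: inversions_def)
      then show ?thesis using 2 s1[of a] s2[of a b] by (auto simp: inversions_def)
    qed
  qed
  have "(i, Suc i) \<notin> ?f ` inversions w"
  proof
    assume "(i, Suc i) \<in> ?f ` inversions w"
    then obtain a b where "i = ?s a" "Suc i = ?s b" "(a, b) \<in> inversions w" by auto
    then have "a = Suc i" "b = i" by (metis transpose_apply_first transpose_involutory,
      metis transpose_apply_second transpose_involutory)
    then show False using \<open>(a, b) \<in> inversions w\<close> by (simp add: inversions_def)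
  qed
  moreover have "inj_on ?f (inversions w)"
    by (rule inj_onI) (auto simp: transpose_eq_iff)
  ultimately show ?thesis
    by (simp add: perm_length_inversions eq finite_inversions w card_image)
qed

lemma perm_length_swap_descent:
  assumes w: "is_perm w" and i: "1 \<le> i" and desc: "w (Suc i) < w i"
  shows "Suc (perm_length (swap_adjacent w i)) = perm_length w"
  using perm_length_swap_ascent[of "swap_adjacent w i" i] assms
  by (simp add: is_perm_swap_positions)

lemma perm_length_id [simp]: "perm_length id = 0"
proof -
  have "inversions id = {}" by (auto simp: inversions_def)
  then show ?thesis by (simp add: perm_length_inversions)
qed

text \<open>If \<open>w\<close> increases from position \<open>1\<close> on and fixes all numbers below \<open>i\<close>, then the position that
  holds \<open>i\<close> can be neither to the left nor to the right of \<open>i\<close>.\<close>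

lemma perm_without_descents:
  assumes w: "is_perm w" and asc: "\<And>i. 1 \<le> i \<Longrightarrow> w i < w (Suc i)"
  shows "w = id"
proof -
  have mono: "w i < w j" if "1 \<le> i" "i < j" for i j
    using that(2,1) by (induction i j rule: less_Suc_induct) (use asc in auto)
  then have "inversions w = {}" unfolding inversions_def by (force dest: less_asym)
  have "w i = i" for i
  proof (induction i rule: less_induct)
    case (less i)
    show ?case
    proof (rule ccontr)
      assume ne: "w i \<noteq> i"
      have "bij w" using w by (auto simp: is_perm_def permutes_bij)
      then obtain j where j: "w j = i" by (metis bij_pointE)
      have "i \<noteq> 0" using ne w by (metis is_perm_zero)
      have "\<not> j < i" using less j by force
      then have "i < j" using j ne by (metis linorder_neqE_nat)
      then have "w i < i" using mono[of i j] j \<open>i \<noteq> 0\<close> by simp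
      then have "w (w i) = w i" using less by blast
      then show False using ne w by (simp add: is_perm_eq_iff)
    qed
  qed
  then show ?thesis by (simp add: fun_eq_iff)
qed

lemma perm_descent_exists:
  assumes "is_perm w" "w \<noteq> id" shows "\<exists>i\<ge>1. w (Suc i) < w i"
  using perm_without_descents[OF assms(1)] assms
  by (metis is_perm_eq_iff linorder_neqE_nat n_not_Suc_n)

lemma perm_length_0_iff: "is_perm w \<Longrightarrow> perm_length w = 0 \<longleftrightarrow> w = id"
  by (metis perm_descent_exists perm_length_id perm_length_swap_descent nat.simps(3))

section \<open>Schubert polynomials as sums over ordered lists of factors\<close>

definition word_perm :: "nat list \<Rightarrow> nat \<Rightarrow> nat" where
  "word_perm \<rho> = apply_path id (map (\<lambda>i. (i, i + 1)) \<rho>)"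

lemma word_perm_Nil [simp]: "word_perm [] = id"
  by (simp add: word_perm_def apply_path_def)

lemma word_perm_snoc [simp]: "word_perm (\<rho> @ [i]) = swap_adjacent (word_perm \<rho>) i"
  by (simp add: word_perm_def apply_path_def)

lemma reduced_expressions_word_perm:
  "reduced_expressions w = {\<rho>. length \<rho> = perm_length w \<and> (\<forall>i \<in> set \<rho>. 1 \<le> i) \<and> word_perm \<rho> = w}"
  by (simp add: reduced_expressions_def word_perm_def)

lemma perm_length_swap_le:
  assumes "is_perm w" "1 \<le> i"
  shows "perm_length (swap_adjacent w i) \<le> Suc (perm_length w)"
  using perm_length_swap_ascent[OF assms] perm_length_swap_descent[OF assms] is_perm_eq_iff[OF assms(1), of i "Suc i"]
  by (metis Suc_leD Suc_n_not_le_n le_SucI linorder_le_cases nat_neq_iff order_refl)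

lemma word_perm:
  "\<forall>i \<in> set \<rho>. 1 \<le> i \<Longrightarrow> is_perm (word_perm \<rho>) \<and> perm_length (word_perm \<rho>) \<le> length \<rho>"
proof (induction \<rho> rule: rev_induct)
  case (snoc i \<rho>)
  then have "is_perm (word_perm \<rho>)" "perm_length (word_perm \<rho>) \<le> length \<rho>" "1 \<le> i" by auto
  then have "is_perm (swap_adjacent (word_perm \<rho>) i)"
    "perm_length (swap_adjacent (word_perm \<rho>) i) \<le> Suc (length \<rho>)"
    using perm_length_swap_le[of "word_perm \<rho>" i] is_perm_swap_positions[of "word_perm \<rho>" i "Suc i"] by auto
  then show ?case unfolding word_perm_snoc length_append_singleton by blast
qed simp

text \<open>Removing the last letter turns a reduced expression of \<open>w\<close> into one of \<open>w s\<^sub>i\<close>. This is the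
  recursion that all later sums over reduced expressions follow.\<close>

lemma snoc_reduced_expressions:
  assumes w: "is_perm w"
  shows "\<rho> @ [i] \<in> reduced_expressions w \<longleftrightarrow>
    1 \<le> i \<and> w (Suc i) < w i \<and> \<rho> \<in> reduced_expressions (swap_adjacent w i)"
proof
  assume L: "\<rho> @ [i] \<in> reduced_expressions w"
  then have i: "1 \<le> i" and wp: "swap_adjacent (word_perm \<rho>) i = w" and len: "perm_length w = Suc (length \<rho>)"
    and pos: "\<forall>i \<in> set \<rho>. 1 \<le> i"
    by (auto simp: reduced_expressions_word_perm)
  from wp have wp': "word_perm \<rho> = swap_adjacent w i" by (metis swap_positions_involutory)
  have le: "perm_length (swap_adjacent w i) \<le> length \<rho>" using word_perm[OF pos] wp' by simp
  have desc: "w (Suc i) < w i"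
  proof (rule ccontr)
    assume "\<not> w (Suc i) < w i"
    then have "w i < w (Suc i)" using w by (metis is_perm_eq_iff linorder_neqE_nat n_not_Suc_n)
    then show False using perm_length_swap_ascent[OF w i] le len by simp
  qed
  then show "1 \<le> i \<and> w (Suc i) < w i \<and> \<rho> \<in> reduced_expressions (swap_adjacent w i)"
    using perm_length_swap_descent[OF w i desc] i pos wp' len by (simp add: reduced_expressions_word_perm)
next
  assume R: "1 \<le> i \<and> w (Suc i) < w i \<and> \<rho> \<in> reduced_expressions (swap_adjacent w i)"
  then show "\<rho> @ [i] \<in> reduced_expressions w"
    using perm_length_swap_descent[OF w, of i] by (auto simp: reduced_expressions_word_perm)
qed

lemma Nil_reduced_expressions: "is_perm w \<Longrightarrow> [] \<in> reduced_expressions w \<longleftrightarrow> w = id"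
  using perm_length_0_iff[of w] by (auto simp: reduced_expressions_word_perm)

lemma reduced_expression_letters:
  assumes "is_perm w" "fixes_above (Suc N) w" "\<rho> \<in> reduced_expressions w"
  shows "set \<rho> \<subseteq> {1..N}"
  using assms
proof (induction \<rho> arbitrary: w rule: rev_induct)
  case (snoc i \<rho>)
  then have i: "1 \<le> i" "w (Suc i) < w i" "\<rho> \<in> reduced_expressions (swap_adjacent w i)"
    using snoc_reduced_expressions by auto
  have "i \<le> N"
  proof (rule ccontr)
    assume "\<not> i \<le> N"
    then have "w (Suc i) = Suc i" using snoc(3) by (simp add: fixes_above_def)
    moreover have "w i \<le> i" using \<open>\<not> i \<le> N\<close> snoc(2,3) fixes_above_le[of w "Suc N" "Suc N"]
      by (cases "i = Suc N") (auto simp: fixes_above_def)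
    ultimately show False using i by simp
  qed
  moreover have "set \<rho> \<subseteq> {1..N}"
  proof (rule snoc.IH)
    show "is_perm (swap_adjacent w i)" by (rule is_perm_swap_positions) (use snoc.prems i in auto)
    show "fixes_above (Suc N) (swap_adjacent w i)"
      by (rule fixes_above_transpose) (use snoc.prems \<open>i \<le> N\<close> in auto)
  qed (rule i(3))
  ultimately show ?case using i by simp
qed simp

lemma reduced_expression_prefix:
  "is_perm w \<Longrightarrow> \<rho> @ \<sigma> \<in> reduced_expressions w \<Longrightarrow> \<exists>v. is_perm v \<and> \<rho> \<in> reduced_expressions v"
proof (induction \<sigma> arbitrary: w rule: rev_induct)
  case (snoc i \<sigma>)
  have "(\<rho> @ \<sigma>) @ [i] \<in> reduced_expressions w" using snoc by simp
  then have "1 \<le> i" "\<rho> @ \<sigma> \<in> reduced_expressions (swap_adjacent w i)"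
    using snoc_reduced_expressions[OF snoc(2)] by blast+
  then show ?case using snoc by (metis is_perm_swap_positions le_Suc_eq le_add1 plus_1_eq_Suc)
qed auto

lemma reduced_expression_adjacent_distinct:
  assumes "is_perm w" "\<rho> \<in> reduced_expressions w" "Suc j < length \<rho>"
  shows "\<rho> ! j \<noteq> \<rho> ! Suc j"
proof
  assume eq: "\<rho> ! j = \<rho> ! Suc j"
  have "\<rho> = take j \<rho> @ [\<rho> ! j] @ [\<rho> ! Suc j] @ drop (Suc (Suc j)) \<rho>"
    using assms(3) by (simp add: Cons_nth_drop_Suc)
  then obtain v where v: "is_perm v" "(take j \<rho> @ [\<rho> ! j]) @ [\<rho> ! j] \<in> reduced_expressions v"
    using reduced_expression_prefix[OF assms(1), of "take j \<rho> @ [\<rho> ! j] @ [\<rho> ! Suc j]" "drop (Suc (Suc j)) \<rho>"]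
      assms(2) eq by auto
  have i: "1 \<le> \<rho> ! j" "v (Suc (\<rho> ! j)) < v (\<rho> ! j)"
    "take j \<rho> @ [\<rho> ! j] \<in> reduced_expressions (swap_adjacent v (\<rho> ! j))"
    using snoc_reduced_expressions[OF v(1), of "take j \<rho> @ [\<rho> ! j]" "\<rho> ! j"] v(2) by blast+
  then have "swap_adjacent v (\<rho> ! j) (Suc (\<rho> ! j)) < swap_adjacent v (\<rho> ! j) (\<rho> ! j)"
    using snoc_reduced_expressions[of "swap_adjacent v (\<rho> ! j)" "take j \<rho>" "\<rho> ! j"]
      is_perm_swap_positions[OF v(1), of "\<rho> ! j" "Suc (\<rho> ! j)"] by auto
  then show False using i by simp
qed

text \<open>A reduced expression with a compatible sequence selects factors of the product
  \<open>\<Prod>\<^sub>a (1 + x\<^sub>a u\<^sub>N) (1 + x\<^sub>a u\<^bsub>N-1\<^esub>) \<cdots> (1 + x\<^sub>a u\<^sub>a)\<close>: the pair \<open>(a, i)\<close> stands for the factor \<open>1 + x\<^sub>a u\<^sub>i\<close>,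
  and the order below is the order of the factors in the product.\<close>

definition factor_before :: "nat \<times> nat \<Rightarrow> nat \<times> nat \<Rightarrow> bool" where
  "factor_before p q \<longleftrightarrow> fst p < fst q \<or> (fst p = fst q \<and> snd q < snd p)"

lemma transp_factor_before: "transp factor_before"
  by (rule transpI) (auto simp: factor_before_def)

lemma factor_before_irrefl: "\<not> factor_before p p"
  by (simp add: factor_before_def)

definition factor_lists :: "(nat \<times> nat) set \<Rightarrow> (nat \<Rightarrow> nat) \<Rightarrow> (nat \<times> nat) list set" where
  "factor_lists A w = {p. sorted_wrt factor_before p \<and> set p \<subseteq> A \<and> map snd p \<in> reduced_expressions w}"

definition weight :: "(nat \<times> nat) list \<Rightarrow> ipoly" where
  "weight p = prod_list (map (\<lambda>f. X (fst f)) p)"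

definition partial_schubert :: "(nat \<times> nat) set \<Rightarrow> (nat \<Rightarrow> nat) \<Rightarrow> ipoly" where
  "partial_schubert A w = (\<Sum>p \<in> factor_lists A w. weight p)"

lemma finite_factor_lists: "finite A \<Longrightarrow> finite (factor_lists A w)"
  by (rule finite_subset[OF _ finite_lists_length_eq[of A "perm_length w"]])
     (auto simp: factor_lists_def reduced_expressions_def)

text \<open>Compatibility of \<open>\<alpha>\<close> with \<open>\<rho>\<close> says that the pairs \<open>(\<alpha>\<^sub>j, \<rho>\<^sub>j)\<close> strictly increase in the order of the
  factors. A pair with \<open>\<alpha>\<^sub>j = \<alpha>\<^bsub>j+1\<^esub>\<close> and \<open>\<rho>\<^sub>j = \<rho>\<^bsub>j+1\<^esub>\<close> satisfies the conditions on \<open>\<alpha>\<close> as well, but cannot occur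
  since equal neighbouring letters are never reduced. The letters of all reduced expressions are bounded,
  so finitely many factors suffice and the sums are finite.\<close>

lemma schubert_eq_partial:
  assumes w: "is_perm w" and N: "fixes_above (Suc N) w"
  shows "schubert w = partial_schubert {(b, j). 1 \<le> b \<and> b \<le> j \<and> j \<le> N} w"
proof -
  let ?A = "{(b, j). 1 \<le> b \<and> b \<le> j \<and> j \<le> N}"
  have letters: "set \<rho> \<subseteq> {1..N}" if "\<rho> \<in> reduced_expressions w" for \<rho>
    using reduced_expression_letters[OF w N that] .
  have finR: "finite (reduced_expressions w)"
    by (rule finite_subset[OF _ finite_lists_length_eq[of "{1..N}" "perm_length w"]])
       (use letters in \<open>auto simp: reduced_expressions_def\<close>)
  have finC: "finite (compatible_seqs \<rho>)" if "\<rho> \<in> reduced_expressions w" for \<rho>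
  proof (rule finite_subset[OF _ finite_lists_length_eq[of "{1..N}" "length \<rho>"]])
    show "compatible_seqs \<rho> \<subseteq> {xs. set xs \<subseteq> {1..N} \<and> length xs = length \<rho>}"
    proof (intro subsetI CollectI conjI)
      fix \<alpha> a assume \<alpha>: "\<alpha> \<in> compatible_seqs \<rho>" and a: "a \<in> set \<alpha>"
      then obtain j where "j < length \<rho>" "a = \<alpha> ! j" by (auto simp: compatible_seqs_def in_set_conv_nth)
      then have "a \<le> \<rho> ! j" "\<rho> ! j \<in> set \<rho>" using \<alpha> by (auto simp: compatible_seqs_def)
      then have "a \<le> N" using letters[OF that] by fastforce
      then show "a \<in> {1..N}" using \<alpha> a by (simp add: compatible_seqs_def)
    qed (simp add: compatible_seqs_def)
  qed simp
  have compat: "\<alpha> \<in> compatible_seqs \<rho> \<longleftrightarrow>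
      sorted_wrt factor_before (zip \<alpha> \<rho>) \<and> set (zip \<alpha> \<rho>) \<subseteq> ?A"
    if len: "length \<alpha> = length \<rho>" and \<rho>: "\<rho> \<in> reduced_expressions w" for \<alpha> \<rho>
  proof -
    have sw: "sorted_wrt factor_before (zip \<alpha> \<rho>) \<longleftrightarrow>
        (\<forall>j. Suc j < length \<rho> \<longrightarrow> \<alpha> ! j < \<alpha> ! Suc j \<or> (\<alpha> ! j = \<alpha> ! Suc j \<and> \<rho> ! Suc j < \<rho> ! j))"
      using len by (simp add: sorted_wrt_iff_nth_Suc_transp[OF transp_factor_before] factor_before_def)
    have dist: "\<rho> ! j \<noteq> \<rho> ! Suc j" if "Suc j < length \<rho>" for j
      using reduced_expression_adjacent_distinct[OF w \<rho> that] .
    have A: "set (zip \<alpha> \<rho>) \<subseteq> ?A \<longleftrightarrow> (\<forall>j < length \<rho>. 1 \<le> \<alpha> ! j \<and> \<alpha> ! j \<le> \<rho> ! j \<and> \<rho> ! j \<le> N)"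
      using len by (force simp: set_zip)
    have N': "\<rho> ! j \<le> N" if "j < length \<rho>" for j using letters[OF \<rho>] that by (meson atLeastAtMost_iff nth_mem subsetD)
    have pos: "(\<forall>a \<in> set \<alpha>. 1 \<le> a) \<longleftrightarrow> (\<forall>j < length \<rho>. 1 \<le> \<alpha> ! j)"
      using len by (metis in_set_conv_nth)
    have srt: "sorted \<alpha> \<longleftrightarrow> (\<forall>j. Suc j < length \<rho> \<longrightarrow> \<alpha> ! j \<le> \<alpha> ! Suc j)"
      using len by (simp add: sorted_iff_nth_Suc)
    have adj: "(\<alpha> ! j \<le> \<alpha> ! Suc j \<and> (\<rho> ! j < \<rho> ! Suc j \<longrightarrow> \<alpha> ! j < \<alpha> ! Suc j)) \<longleftrightarrow>
       (\<alpha> ! j < \<alpha> ! Suc j \<or> (\<alpha> ! j = \<alpha> ! Suc j \<and> \<rho> ! Suc j < \<rho> ! j))" if "Suc j < length \<rho>" for j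
      using dist[OF that] by auto
    show ?thesis
      unfolding compatible_seqs_def mem_Collect_eq sw A srt pos using len adj N' by blast
  qed
  have "schubert w = (\<Sum>(\<rho>, \<alpha>) \<in> Sigma (reduced_expressions w) compatible_seqs. prod_list (map X \<alpha>))"
    unfolding schubert_def by (rule sum.Sigma) (use finR finC in auto)
  also have "\<dots> = partial_schubert ?A w"
    unfolding partial_schubert_def
  proof (rule sum.reindex_bij_witness[where i = "\<lambda>p. (map snd p, map fst p)" and j = "\<lambda>(\<rho>, \<alpha>). zip \<alpha> \<rho>"])
    fix p assume p: "p \<in> factor_lists ?A w"
    then show "(map snd p, map fst p) \<in> Sigma (reduced_expressions w) compatible_seqs"
      using compat[of "map fst p" "map snd p"] by (simp add: factor_lists_def zip_map_fst_snd)
    show "(\<lambda>(\<rho>, \<alpha>). zip \<alpha> \<rho>) (map snd p, map fst p) = p" by (simp add: zip_map_fst_snd)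
  next
    fix q assume q: "q \<in> Sigma (reduced_expressions w) compatible_seqs"
    obtain \<rho> \<alpha> where q': "q = (\<rho>, \<alpha>)" by fastforce
    have *: "\<rho> \<in> reduced_expressions w" "\<alpha> \<in> compatible_seqs \<rho>" using q q' by auto
    then have len: "length \<alpha> = length \<rho>" by (simp add: compatible_seqs_def)
    show "(\<lambda>(\<rho>, \<alpha>). zip \<alpha> \<rho>) q \<in> factor_lists ?A w"
      using compat[OF len *(1)] * len by (simp add: q' factor_lists_def)
    show "(map snd ((\<lambda>(\<rho>, \<alpha>). zip \<alpha> \<rho>) q), map fst ((\<lambda>(\<rho>, \<alpha>). zip \<alpha> \<rho>) q)) = q"
      using len by (simp add: q')
    have "map (\<lambda>f. X (fst f)) (zip \<alpha> \<rho>) = map X \<alpha>"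
      using len by (metis (no_types, lifting) map_fst_zip map_map map_eq_conv comp_apply)
    then show "weight ((\<lambda>(\<rho>, \<alpha>). zip \<alpha> \<rho>) q) = (case q of (\<rho>, \<alpha>) \<Rightarrow> prod_list (map X \<alpha>))"
      by (simp add: q' weight_def)
  qed
  finally show ?thesis .
qed

text \<open>Formal sums of permutations with polynomial coefficients form a module over the nilCoxeter
  algebra. The generator \<open>u\<^sub>i\<close> (\<open>nil_op\<close>) multiplies from the right by \<open>s\<^sub>i\<close> and kills what does not
  get longer; \<open>factor_op x i\<close> is multiplication by \<open>1 + x u\<^sub>i\<close>, and \<open>row_op x i n\<close> by
  \<open>(1 + x u\<^bsub>i+n-1\<^esub>) \<cdots> (1 + x u\<^sub>i)\<close>.\<close>

type_synonym perm_series = "(nat \<Rightarrow> nat) \<Rightarrow> ipoly"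

definition nil_op :: "nat \<Rightarrow> perm_series \<Rightarrow> perm_series" where
  "nil_op i g w = (if w (Suc i) < w i then g (swap_adjacent w i) else 0)"

definition factor_op :: "ipoly \<Rightarrow> nat \<Rightarrow> perm_series \<Rightarrow> perm_series" where
  "factor_op x i g w = g w + x * nil_op i g w"

fun row_op :: "ipoly \<Rightarrow> nat \<Rightarrow> nat \<Rightarrow> perm_series \<Rightarrow> perm_series" where
  "row_op x i 0 g = g"
| "row_op x i (Suc n) g = factor_op x i (row_op x (Suc i) n g)"

text \<open>A list of factors that respects the order either avoids the last factor \<open>(a, i)\<close> or ends with it.\<close>

lemma partial_schubert_insert:
  assumes w: "is_perm w" and i: "1 \<le> i" and fin: "finite A"
    and last: "\<And>f. f \<in> A \<Longrightarrow> factor_before f (a, i)"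
  shows "partial_schubert (insert (a, i) A) w = factor_op (X a) i (partial_schubert A) w"
proof -
  let ?B = "insert (a, i) A"
  have new: "(a, i) \<notin> A" using last factor_before_irrefl by blast
  have no_later: "\<not> factor_before (a, i) f" if "f \<in> ?B" for f
    using last[of f] that by (auto simp: factor_before_def)
  define Q where "Q = (if w (Suc i) < w i then (\<lambda>p. p @ [(a, i)]) ` factor_lists A (swap_adjacent w i) else {})"
  have split: "factor_lists ?B w = factor_lists A w \<union> Q"
  proof (intro equalityI subsetI)
    fix p assume p: "p \<in> factor_lists ?B w"
    show "p \<in> factor_lists A w \<union> Q"
    proof (cases "(a, i) \<in> set p")
      case False
      then show ?thesis using p by (auto simp: factor_lists_def)
    next
      case True
      then obtain ys zs where ys: "p = ys @ (a, i) # zs" by (meson split_list)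
      have sorted: "sorted_wrt factor_before p" "set p \<subseteq> ?B" "map snd p \<in> reduced_expressions w"
        using p by (auto simp: factor_lists_def)
      have "zs = []"
      proof (rule ccontr)
        assume "zs \<noteq> []"
        then obtain z where "z \<in> set zs" by (meson last_in_set)
        then show False using sorted(1,2) no_later[of z] by (auto simp: ys sorted_wrt_append)
      qed
      then have p': "p = ys @ [(a, i)]" by (simp add: ys)
      have "(a, i) \<notin> set ys" using sorted(1) factor_before_irrefl by (auto simp: p' sorted_wrt_append)
      then have "set ys \<subseteq> A" using sorted(2) by (auto simp: p')
      then have "w (Suc i) < w i \<and> ys \<in> factor_lists A (swap_adjacent w i)"
        using sorted snoc_reduced_expressions[OF w, of "map snd ys" i]
        by (simp add: factor_lists_def p' sorted_wrt_append)
      then show ?thesis by (auto simp: Q_def p')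
    qed
  next
    fix p assume "p \<in> factor_lists A w \<union> Q"
    then show "p \<in> factor_lists ?B w"
    proof
      assume "p \<in> factor_lists A w" then show ?thesis by (auto simp: factor_lists_def)
    next
      assume "p \<in> Q"
      then obtain ys where ys: "p = ys @ [(a, i)]" "w (Suc i) < w i" "ys \<in> factor_lists A (swap_adjacent w i)"
        by (auto simp: Q_def split: if_splits)
      then show ?thesis
        using snoc_reduced_expressions[OF w, of "map snd ys" i] i last
        by (auto simp: factor_lists_def sorted_wrt_append)
    qed
  qed
  have disj: "factor_lists A w \<inter> Q = {}" using new by (auto simp: Q_def factor_lists_def)
  have "partial_schubert ?B w = partial_schubert A w + (\<Sum>p\<in>Q. weight p)"
    unfolding partial_schubert_def split
    by (rule sum.union_disjoint) (use fin disj finite_factor_lists in \<open>auto simp: Q_def\<close>)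
  also have "(\<Sum>p\<in>Q. weight p) = X a * nil_op i (partial_schubert A) w"
  proof (cases "w (Suc i) < w i")
    case True
    have "(\<Sum>p\<in>Q. weight p) = (\<Sum>p\<in>factor_lists A (swap_adjacent w i). weight (p @ [(a, i)]))"
      using True by (simp add: Q_def sum.reindex inj_on_def)
    then show ?thesis using True
      by (simp add: nil_op_def partial_schubert_def sum_distrib_left weight_def mult.commute)
  qed (simp add: Q_def nil_op_def)
  finally show ?thesis by (simp add: factor_op_def)
qed

lemma row_op_partial_schubert:
  assumes "is_perm w" "1 \<le> i" "finite A" "\<And>f. f \<in> A \<Longrightarrow> fst f < a"
  shows "row_op (X a) i n (partial_schubert A) w = partial_schubert (A \<union> {a} \<times> {i..<i + n}) w"
  using assms
proof (induction n arbitrary: i w)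
  case (Suc n)
  let ?A = "A \<union> {a} \<times> {Suc i..<Suc i + n}"
  have IH: "row_op (X a) (Suc i) n (partial_schubert A) v = partial_schubert ?A v" if "is_perm v" for v
    using Suc that by simp
  have "row_op (X a) i (Suc n) (partial_schubert A) w = factor_op (X a) i (partial_schubert ?A) w"
    using Suc.prems IH[of w] IH[of "swap_adjacent w i"]
    by (simp add: factor_op_def nil_op_def is_perm_swap_positions)
  also have "\<dots> = partial_schubert (insert (a, i) ?A) w"
    by (rule partial_schubert_insert[symmetric]) (use Suc.prems in \<open>auto simp: factor_before_def\<close>)
  also have "insert (a, i) ?A = A \<union> {a} \<times> {i..<i + Suc n}" by (auto simp: le_less Suc_le_eq)
  finally show ?case .
qed simp

definition delta_id :: perm_series where "delta_id w = (if w = id then 1 else 0)"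

fun row_product :: "nat \<Rightarrow> nat \<Rightarrow> perm_series" where
  "row_product N 0 = delta_id"
| "row_product N (Suc a) = row_op (X (Suc a)) (Suc a) (N - a) (row_product N a)"

lemma row_op_cong:
  assumes "\<And>v. is_perm v \<Longrightarrow> g v = h v" "1 \<le> i" "is_perm w"
  shows "row_op x i n g w = row_op x i n h w"
  using assms(2,3)
  by (induction n arbitrary: i w) (simp_all add: assms(1) factor_op_def nil_op_def is_perm_swap_positions)

lemma row_product_partial_schubert:
  assumes "is_perm w" "a \<le> N"
  shows "row_product N a w = partial_schubert {(b, j). 1 \<le> b \<and> b \<le> a \<and> b \<le> j \<and> j \<le> N} w"
  using assms
proof (induction a arbitrary: w)
  case 0
  have "p \<in> factor_lists {} w \<longleftrightarrow> p = [] \<and> w = id" for p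
    using Nil_reduced_expressions[OF 0(1)] unfolding factor_lists_def mem_Collect_eq
    by (metis empty_subsetI list.map(1) list.set(1) set_empty subset_empty sorted_wrt.simps(1))
  then have lists: "factor_lists {} w = (if w = id then {[]} else {})" by auto
  have factors: "{(b, j). 1 \<le> b \<and> b \<le> 0 \<and> b \<le> j \<and> j \<le> N} = ({} :: (nat \<times> nat) set)" by auto
  show ?case unfolding factors partial_schubert_def lists by (simp add: delta_id_def weight_def)
next
  case (Suc a)
  let ?A = "{(b, j). 1 \<le> b \<and> b \<le> a \<and> b \<le> j \<and> j \<le> N}"
  have fin: "finite ?A" by (rule finite_subset[of _ "{..N} \<times> {..N}"]) auto
  have "row_product N (Suc a) w = row_op (X (Suc a)) (Suc a) (N - a) (partial_schubert ?A) w"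
    unfolding row_product.simps by (rule row_op_cong) (use Suc in auto)
  also have "\<dots> = partial_schubert (?A \<union> {Suc a} \<times> {Suc a..<Suc a + (N - a)}) w"
    by (rule row_op_partial_schubert) (use Suc fin in auto)
  also have "?A \<union> {Suc a} \<times> {Suc a..<Suc a + (N - a)} = {(b, j). 1 \<le> b \<and> b \<le> Suc a \<and> b \<le> j \<and> j \<le> N}"
    using Suc.prems by auto
  finally show ?case .
qed

lemma schubert_row_product:
  assumes "is_perm w" "fixes_above (Suc N) w"
  shows "schubert w = row_product N N w"
proof -
  have "{(b, j). 1 \<le> b \<and> b \<le> N \<and> b \<le> j \<and> j \<le> N} = {(b, j). 1 \<le> b \<and> b \<le> j \<and> j \<le> N}" by auto
  then show ?thesis using schubert_eq_partial[OF assms] row_product_partial_schubert[OF assms(1), of N N] by simp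
qed

section \<open>The theorem of Fomin and Stanley\<close>

lemma nil_op_square: "nil_op i (nil_op i g) = (\<lambda>w. 0)"
  by (auto simp: nil_op_def fun_eq_iff)

lemma swap_positions_commute:
  assumes "{a, b} \<inter> {c, d} = {}"
  shows "swap_positions (swap_positions w (a, b)) (c, d) = swap_positions (swap_positions w (c, d)) (a, b)"
  using assms by (auto simp: fun_eq_iff transpose_def)

lemma nil_op_commute:
  assumes "Suc i < j" shows "nil_op i (nil_op j g) = nil_op j (nil_op i g)"
proof
  fix w
  have "swap_adjacent (swap_adjacent w i) j = swap_adjacent (swap_adjacent w j) i"
    by (rule swap_positions_commute) (use assms in auto)
  then show "nil_op i (nil_op j g) w = nil_op j (nil_op i g) w"
    using assms by (simp add: nil_op_def transpose_apply_other)
qed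

lemma nil_op_braid:
  "nil_op i (nil_op (Suc i) (nil_op i g)) = nil_op (Suc i) (nil_op i (nil_op (Suc i) g))"
proof
  fix w
  have "swap_adjacent (swap_adjacent (swap_adjacent w i) (Suc i)) i
      = swap_adjacent (swap_adjacent (swap_adjacent w (Suc i)) i) (Suc i)"
    by (auto simp: fun_eq_iff transpose_def)
  then show "nil_op i (nil_op (Suc i) (nil_op i g)) w = nil_op (Suc i) (nil_op i (nil_op (Suc i) g)) w"
    by (simp add: nil_op_def transpose_apply_other)
qed

lemma nil_op_linear:
  "nil_op i (\<lambda>w. g w + h w) = (\<lambda>w. nil_op i g w + nil_op i h w)"
  "nil_op i (\<lambda>w. g w - h w) = (\<lambda>w. nil_op i g w - nil_op i h w)"
  "nil_op i (\<lambda>w. c * g w) = (\<lambda>w. c * nil_op i g w)"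
  "nil_op i (\<lambda>w. 0) = (\<lambda>w. 0)"
  by (auto simp: nil_op_def fun_eq_iff)

lemma factor_op_nil_op: "factor_op x i g = (\<lambda>w. g w + x * nil_op i g w)"
  by (simp add: factor_op_def fun_eq_iff)

lemma factor_op_commute:
  "Suc i < j \<Longrightarrow> factor_op x i (factor_op y j g) = factor_op y j (factor_op x i g)"
  by (simp add: factor_op_nil_op nil_op_linear nil_op_commute[of i j] algebra_simps)

lemma factor_op_same_commute: "factor_op x i (factor_op y i g) = factor_op y i (factor_op x i g)"
  by (simp add: factor_op_nil_op nil_op_linear nil_op_square algebra_simps)

lemma factor_op_inverse: "factor_op (- x) i (factor_op x i g) = g"
  by (simp add: factor_op_nil_op nil_op_linear nil_op_square)

text \<open>In the expansion of either side the cubic terms \<open>u\<^sub>i u\<^bsub>i+1\<^esub> u\<^sub>i\<close> and \<open>u\<^bsub>i+1\<^esub> u\<^sub>i u\<^bsub>i+1\<^esub>\<close> cancel by the braid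
  relation, and what remains is symmetric in \<open>x\<close> and \<open>y\<close>.\<close>

lemma factor_op_exchange:
  "factor_op x i (factor_op x (Suc i) (factor_op y i (factor_op (- x) (Suc i) g)))
 = factor_op y i (factor_op y (Suc i) (factor_op x i (factor_op (- y) (Suc i) g)))"
  by (simp add: factor_op_nil_op nil_op_linear nil_op_square nil_op_braid algebra_simps)

lemma factor_op_row_op_commute:
  "Suc i < j \<Longrightarrow> factor_op x i (row_op y j n g) = row_op y j n (factor_op x i g)"
  by (induction n arbitrary: j) (simp_all add: factor_op_commute[of i])

lemma nil_op_row_op_commute:
  "Suc i < j \<Longrightarrow> nil_op i (row_op y j n g) = row_op y j n (nil_op i g)"
  by (induction n arbitrary: j) (simp_all add: factor_op_nil_op nil_op_linear nil_op_commute[of i])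

text \<open>Two rows that start with the same letter commute. Peeling off the letters \<open>i\<close> and \<open>i + 1\<close>
  leaves two rows that start with \<open>i + 1\<close>, which commute by induction; the row starting with \<open>i + 2\<close>
  is written as \<open>(1 + x u\<^bsub>i+1\<^esub>)\<^sup>-\<^sup>1\<close> times the row starting with \<open>i + 1\<close>.\<close>

lemma row_op_commute: "row_op x i n (row_op y i n g) = row_op y i n (row_op x i n g)"
proof (induction n arbitrary: i g)
  case (Suc n)
  show ?case
  proof (cases n)
    case 0
    then show ?thesis by (simp add: factor_op_same_commute)
  next
    case (Suc m)
    have expand: "row_op x i (Suc n) (row_op y i (Suc n) g)
      = factor_op x i (factor_op x (Suc i) (factor_op y i (factor_op (- x) (Suc i)
          (row_op x (Suc i) n (row_op y (Suc i) n g)))))" for x y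
    proof -
      have "row_op x i (Suc n) (row_op y i (Suc n) g)
        = factor_op x i (factor_op x (Suc i) (factor_op y i (row_op x (Suc (Suc i)) m (row_op y (Suc i) n g))))"
        by (simp add: Suc factor_op_row_op_commute)
      also have "row_op x (Suc (Suc i)) m h = factor_op (- x) (Suc i) (row_op x (Suc i) n h)" for h
        by (simp add: Suc factor_op_inverse)
      finally show ?thesis .
    qed
    show ?thesis
      unfolding expand Suc.IH[of "Suc i"] by (rule factor_op_exchange)
  qed
qed simp

lemma row_op_linear:
  "row_op y j n (\<lambda>w. g w - h w) = (\<lambda>w. row_op y j n g w - row_op y j n h w)"
  "row_op y j n (\<lambda>w. c * g w) = (\<lambda>w. c * row_op y j n g w)"
  by (induction n arbitrary: j) (simp_all add: factor_op_nil_op nil_op_linear algebra_simps)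

lemma swap_vars_nil_op: "(\<lambda>w. swap_vars i (nil_op j g w)) = nil_op j (\<lambda>w. swap_vars i (g w))"
  by (auto simp: nil_op_def fun_eq_iff)

lemma swap_vars_row_op:
  "(\<lambda>w. swap_vars i (row_op x j n g w)) = row_op (swap_vars i x) j n (\<lambda>w. swap_vars i (g w))"
proof (induction n arbitrary: j)
  case (Suc n)
  have "swap_vars i (row_op x j (Suc n) g w) = row_op (swap_vars i x) j (Suc n) (\<lambda>w. swap_vars i (g w)) w" for w
    using fun_cong[OF Suc[of "Suc j"]]
      fun_cong[OF swap_vars_nil_op[of i j "row_op x (Suc j) n g", unfolded Suc], of w]
    by (simp add: factor_op_def swap_vars_add swap_vars_mult)
  then show ?case by blast
qed simp

lemma swap_vars_row_product_below:
  "1 \<le> i \<Longrightarrow> a < i \<Longrightarrow> (\<lambda>w. swap_vars i (row_product N a w)) = row_product N a"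
proof (induction a)
  case 0
  then show ?case by (auto simp: delta_id_def)
next
  case (Suc a)
  then have "swap_vars i (X (Suc a)) = X (Suc a)"
    by (simp add: swap_vars_X transpose_apply_other)
  then show ?case using Suc by (simp add: swap_vars_row_op)
qed

text \<open>Only the rows \<open>i\<close> and \<open>i + 1\<close> contain \<open>x\<^sub>i\<close> and \<open>x\<^bsub>i+1\<^esub>\<close>. Their product is \<open>1 - x\<^bsub>i+1\<^esub> u\<^sub>i\<close> times a product
  \<open>C\<close> of two rows starting with \<open>i\<close>, and \<open>C\<close> is symmetric in the two variables because those rows
  commute. So the exchange of the variables changes the product by \<open>(x\<^sub>i - x\<^bsub>i+1\<^esub>) u\<^sub>i C\<close>; the later rows only involve letters
  that commute with \<open>u\<^sub>i\<close>.\<close>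

lemma row_product_swap_vars:
  assumes "1 \<le> i" "i < N" "Suc i \<le> a"
  shows "(\<lambda>w. row_product N a w - swap_vars i (row_product N a w))
       = (\<lambda>w. (X i - X (Suc i)) * nil_op i (row_product N a) w)"
  using assms(3)
proof (induction a rule: dec_induct)
  case base
  obtain a where a: "i = Suc a" using assms(1) by (cases i) auto
  obtain n where n: "N - a = Suc n" "N - i = n" using assms(2) a by (metis Suc_diff_Suc Suc_lessD)
  define g where "g = row_product N a"
  have g: "(\<lambda>w. swap_vars i (g w)) = g"
    unfolding g_def by (rule swap_vars_row_product_below) (use a in auto)
  define C where "C = row_op (X (Suc i)) i (Suc n) (row_op (X i) i (Suc n) g)"
  have fact: "row_op y (Suc i) n h = factor_op (- y) i (row_op y i (Suc n) h)" for y h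
    by (simp add: factor_op_inverse)
  have "row_product N (Suc i) = row_op (X (Suc i)) (Suc i) n (row_op (X i) i (Suc n) g)"
    unfolding row_product.simps(2)[of N i] n(2) using n(1) by (simp add: a g_def del: row_op.simps)
  then have P: "row_product N (Suc i) = factor_op (- X (Suc i)) i C"
    unfolding C_def fact .
  have "(\<lambda>w. swap_vars i (C w)) = C"
    unfolding C_def swap_vars_row_op g by (simp add: swap_vars_X row_op_commute del: row_op.simps)
  then have C: "swap_vars i (C w) = C w" for w by metis
  have "(\<lambda>w. swap_vars i (nil_op i C w)) = nil_op i C"
    unfolding swap_vars_nil_op C ..
  then have C': "swap_vars i (nil_op i C w) = nil_op i C w" for w by metis
  have "nil_op i (row_product N (Suc i)) = nil_op i C"
    unfolding P by (simp add: factor_op_nil_op nil_op_linear nil_op_square)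
  then show ?case
    unfolding P by (simp add: factor_op_nil_op swap_vars_add swap_vars_diff swap_vars_mult swap_vars_X C C' algebra_simps)
next
  case (step a)
  have X: "swap_vars i (X (Suc a)) = X (Suc a)"
    using step by (simp add: swap_vars_X transpose_apply_other)
  have "(\<lambda>w. row_product N (Suc a) w - swap_vars i (row_product N (Suc a) w))
      = row_op (X (Suc a)) (Suc a) (N - a) (\<lambda>w. row_product N a w - swap_vars i (row_product N a w))"
    using fun_cong[OF swap_vars_row_op[of i "X (Suc a)" "Suc a" "N - a" "row_product N a"]]
    by (simp add: row_op_linear X)
  also have "\<dots> = (\<lambda>w. (X i - X (Suc i)) * row_op (X (Suc a)) (Suc a) (N - a) (nil_op i (row_product N a)) w)"
    unfolding step.IH row_op_linear ..
  also have "row_op (X (Suc a)) (Suc a) (N - a) (nil_op i (row_product N a)) = nil_op i (row_product N (Suc a))"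
    using step by (simp add: nil_op_row_op_commute)
  finally show ?case .
qed

theorem ddiff_schubert:
  assumes w: "is_perm w" and i: "1 \<le> i"
  shows "ddiff i (schubert w) = (if w (Suc i) < w i then schubert (swap_adjacent w i) else 0)"
proof -
  obtain M where M: "fixes_above M w" using is_perm_fixes_above[OF w] by blast
  define N where "N = Suc (max M i)"
  have N: "fixes_above (Suc N) w" "i < N"
    using fixes_above_mono[OF M, of "Suc N"] by (auto simp: N_def)
  have N': "fixes_above (Suc N) (swap_adjacent w i)"
    by (rule fixes_above_transpose) (use N in auto)
  have w': "is_perm (swap_adjacent w i)" by (rule is_perm_swap_positions) (use w i in auto)
  have "schubert w - swap_vars i (schubert w) = (X i - X (Suc i)) * nil_op i (row_product N N) w"
    using fun_cong[OF row_product_swap_vars[OF i N(2), of N], of w] N(2)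
    by (simp add: schubert_row_product[OF w N(1)])
  then have "ddiff i (schubert w) = nil_op i (row_product N N) w"
    using ddiff_unique by metis
  then show ?thesis
    by (simp add: nil_op_def schubert_row_product[OF w' N'])
qed

lemma schubert_id: "schubert id = 1"
proof -
  have "fixes_above (Suc 0) id" by (simp add: fixes_above_def)
  then show ?thesis using schubert_row_product[of id 0] by (simp add: delta_id_def)
qed

lemma const_term_schubert:
  assumes "is_perm w" shows "const_term (schubert w) = (if w = id then 1 else 0)"
proof (cases "w = id")
  case False
  have "const_term (prod_list (map X \<alpha>)) = 0" if "\<rho> \<in> reduced_expressions w" "\<alpha> \<in> compatible_seqs \<rho>" for \<rho> \<alpha>
  proof -
    have "length \<alpha> = perm_length w" using that by (auto simp: reduced_expressions_def compatible_seqs_def)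
    then have "\<alpha> \<noteq> []" using False perm_length_0_iff[OF assms] by auto
    then show ?thesis by (cases \<alpha>) (auto simp: const_term_mult)
  qed
  then show ?thesis using False by (simp add: schubert_def const_term_sum)
qed (simp add: schubert_id)

lemma positive_vars_schubert: "positive_vars (schubert w)"
  unfolding schubert_def
  by (intro positive_vars_sum positive_vars_prod_list) (auto simp: compatible_seqs_def intro!: positive_vars_X)

section \<open>Monk's formula\<close>

definition bruhat_cover :: "(nat \<Rightarrow> nat) \<Rightarrow> nat \<Rightarrow> nat \<Rightarrow> bool" where
  "bruhat_cover w a b \<longleftrightarrow> a < b \<and> w a < w b \<and> (\<forall>c. a < c \<and> c < b \<longrightarrow> \<not> (w a < w c \<and> w c < w b))"

text \<open>The lifting property of the Bruhat order, for covers: if \<open>i\<close> is an ascent of \<open>v\<close> and the cover \<open>v(a, b)\<close>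
  is not \<open>v s\<^sub>i\<close> itself, then \<open>i\<close> is still an ascent of \<open>v(a, b)\<close>, and the cover can be conjugated by
  \<open>s\<^sub>i\<close> into one of \<open>v s\<^sub>i\<close>; every cover of \<open>v s\<^sub>i\<close> that keeps the descent at \<open>i\<close> arises in this way.\<close>

lemma bruhat_cover_lift:
  fixes i a b :: nat
  defines "s \<equiv> Transposition.transpose i (Suc i)"
  assumes v: "is_perm v" and asc: "v i < v (Suc i)" and ab: "a < b" "(a, b) \<noteq> (i, Suc i)"
  shows "bruhat_cover v a b \<longleftrightarrow> bruhat_cover (swap_adjacent v i) (s a) (s b) \<and>
    swap_positions v (a, b) i < swap_positions v (a, b) (Suc i)"
proof -
  note inj = is_perm_eq_iff[OF v]
  have sab: "s a < s b" using ab by (auto simp: s_def transpose_def)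
  have vs: "swap_adjacent v i c = v (s c)" "v (s (s c)) = v c" "swap_adjacent v i (s c) = v c" for c
    by (simp_all add: s_def)
  have cover_s: "bruhat_cover (swap_adjacent v i) (s a) (s b) \<longleftrightarrow>
      v a < v b \<and> (\<forall>c. s a < s c \<and> s c < s b \<longrightarrow> \<not> (v a < v c \<and> v c < v b))"
  proof -
    have *: "(\<forall>c. s a < c \<and> c < s b \<longrightarrow> P (s c)) \<longleftrightarrow> (\<forall>c. s a < s c \<and> s c < s b \<longrightarrow> P c)" for P
      by (metis s_def transpose_involutory)
    show ?thesis
      unfolding *[of "\<lambda>x. \<not> (v a < v x \<and> v x < v b)", symmetric] using sab
      by (simp add: bruhat_cover_def vs flip: s_def)
  qed
  have cover: "bruhat_cover v a b \<longleftrightarrow> v a < v b \<and> (\<forall>c. a < c \<and> c < b \<longrightarrow> \<not> (v a < v c \<and> v c < v b))"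
    using ab by (simp add: bruhat_cover_def)
  have s: "s i = Suc i" "s (Suc i) = i" "c \<noteq> i \<Longrightarrow> c \<noteq> Suc i \<Longrightarrow> s c = c" for c
    by (auto simp: s_def transpose_def)
  consider "a \<noteq> i" "a \<noteq> Suc i" "b \<noteq> i" "b \<noteq> Suc i" | "a = i" "Suc i < b" | "a = Suc i"
    | "b = i" | "b = Suc i" "a < i"
    using ab by (metis Suc_lessI less_antisym)
  then show ?thesis
  proof cases
    case 1
    have "s a < s c \<and> s c < s b \<longleftrightarrow> a < c \<and> c < b" for c
      using 1 by (cases "c = i"; cases "c = Suc i") (auto simp: s)
    then show ?thesis unfolding cover cover_s using 1 asc by (simp add: transpose_apply_other)
  next
    case 2
    have "a < c \<and> c < b \<longleftrightarrow> (s a < s c \<and> s c < s b) \<or> c = Suc i" for c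
      using 2 by (cases "c = i"; cases "c = Suc i") (auto simp: s)
    then have "bruhat_cover v a b \<longleftrightarrow> bruhat_cover (swap_adjacent v i) (s a) (s b) \<and> \<not> (v i < v (Suc i) \<and> v (Suc i) < v b)"
      unfolding cover cover_s using 2(1) by blast
    then show ?thesis using asc 2 inj[of "Suc i" b] by (auto simp: transpose_def)
  next
    case 3
    have "s a < s c \<and> s c < s b \<longleftrightarrow> (a < c \<and> c < b) \<or> c = i" for c
      using 3 ab by (cases "c = i"; cases "c = Suc i") (auto simp: s)
    then have "bruhat_cover (swap_adjacent v i) (s a) (s b) \<longleftrightarrow> bruhat_cover v a b \<and> \<not> (v a < v i \<and> v i < v b)"
      unfolding cover cover_s by blast
    moreover have "v a < v b" if "bruhat_cover v a b" using that unfolding bruhat_cover_def by blast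
    ultimately show ?thesis using asc 3 ab by (auto simp: transpose_def)
  next
    case 4
    have "s a < s c \<and> s c < s b \<longleftrightarrow> (a < c \<and> c < b) \<or> c = Suc i" for c
      using 4 ab by (cases "c = i"; cases "c = Suc i") (auto simp: s)
    then have "bruhat_cover (swap_adjacent v i) (s a) (s b) \<longleftrightarrow> bruhat_cover v a b \<and> \<not> (v a < v (Suc i) \<and> v (Suc i) < v b)"
      unfolding cover cover_s by blast
    moreover have "v a < v b" if "bruhat_cover v a b" using that unfolding bruhat_cover_def by blast
    ultimately show ?thesis using asc 4 ab by (auto simp: transpose_def)
  next
    case 5
    have "a < c \<and> c < b \<longleftrightarrow> (s a < s c \<and> s c < s b) \<or> c = i" for c
      using 5 ab by (cases "c = i"; cases "c = Suc i") (auto simp: s)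
    then have "bruhat_cover v a b \<longleftrightarrow> bruhat_cover (swap_adjacent v i) (s a) (s b) \<and> \<not> (v a < v i \<and> v i < v b)"
      unfolding cover cover_s by blast
    then show ?thesis using asc 5 ab inj[of i a] by (auto simp: transpose_def)
  qed
qed

definition monk_covers :: "nat \<Rightarrow> (nat \<Rightarrow> nat) \<Rightarrow> (nat \<times> nat) set" where
  "monk_covers r w = {(a, b). 1 \<le> a \<and> a \<le> r \<and> r < b \<and> bruhat_cover w a b}"

lemma finite_monk_covers:
  assumes w: "is_perm w" shows "finite (monk_covers r w)"
proof -
  obtain N where N: "fixes_above N w" using is_perm_fixes_above[OF w] by blast
  define M where "M = max N r"
  have M: "fixes_above M w" using N by (rule fixes_above_mono) (simp add: M_def)
  have "monk_covers r w \<subseteq> {..r} \<times> {..Suc M}"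
  proof (clarsimp simp: monk_covers_def)
    fix a b assume ab: "Suc 0 \<le> a" "a \<le> r" "r < b" "bruhat_cover w a b"
    show "b \<le> Suc M"
    proof (rule ccontr)
      assume "\<not> b \<le> Suc M"
      then obtain c where c: "b = Suc c" "M < c" by (cases b) auto
      have "w a \<le> M" using ab by (intro fixes_above_le[OF w M]) (simp add: M_def)
      moreover have "w c = c" "w b = b" using M c by (auto simp: fixes_above_def)
      moreover have "a < c" using c ab by (simp add: M_def)
      ultimately show False using ab(4) c unfolding bruhat_cover_def by (metis lessI order_le_less_trans)
    qed
  qed
  then show ?thesis by (rule finite_subset) simp
qed

lemma is_perm_monk_cover:
  "is_perm w \<Longrightarrow> (a, b) \<in> monk_covers r w \<Longrightarrow> is_perm (swap_positions w (a, b))"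
  by (rule is_perm_swap_positions) (auto simp: monk_covers_def)

definition var_sum :: "nat \<Rightarrow> ipoly" where "var_sum r = (\<Sum>a=1..r. X a)"

lemma var_sum_Suc: "var_sum (Suc r) = var_sum r + X (Suc r)"
  by (simp add: var_sum_def)

lemma var_sum_0 [simp]: "var_sum 0 = 0"
  by (simp add: var_sum_def)

lemma swap_vars_var_sum:
  assumes "1 \<le> i"
  shows "swap_vars i (var_sum r) = (if i = r then var_sum (r - 1) + var_sum (Suc r) - var_sum r else var_sum r)"
proof -
  have below: "swap_vars i (var_sum r) = var_sum r" if "r < i" for r
    using that by (induction r) (auto simp: var_sum_Suc swap_vars_add swap_vars_X transpose_apply_other)
  obtain j where j: "i = Suc j" using assms by (cases i) auto
  have at: "swap_vars i (var_sum i) = var_sum j + X (Suc i)"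
    using below[of j] by (simp add: j var_sum_Suc swap_vars_add swap_vars_X)
  have above: "swap_vars i (var_sum r) = var_sum r" if "Suc i \<le> r" for r
    using that
  proof (induction r rule: dec_induct)
    case base
    then show ?case using at by (simp add: var_sum_Suc swap_vars_add swap_vars_X j)
  next
    case (step r)
    then show ?case by (simp add: var_sum_Suc swap_vars_add swap_vars_X transpose_apply_other)
  qed
  consider "r < i" | "r = i" | "Suc i \<le> r" by linarith
  then show ?thesis using below[of r] above[of r] at by cases (auto simp: var_sum_Suc j)
qed

lemma ddiff_var_sum:
  assumes "1 \<le> i" shows "ddiff i (var_sum r) = (if i = r then 1 else 0)"
proof (rule ddiff_unique)
  obtain j where "i = Suc j" using assms by (cases i) auto
  then show "(X i - X (Suc i)) * (if i = r then 1 else 0) = var_sum r - swap_vars i (var_sum r)"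
    using assms by (auto simp: swap_vars_var_sum var_sum_Suc)
qed

text \<open>The case of a descent in the proof of Monk's formula: the covers of \<open>v s\<^sub>i\<close> that survive the
  divided difference are matched with covers of \<open>v\<close> by conjugation.\<close>

lemma sum_descents_of_covers:
  assumes v: "is_perm v" and i: "1 \<le> i" and asc: "v i < v (Suc i)"
  defines "s \<equiv> Transposition.transpose i (Suc i)"
  shows "(\<Sum>(a, b) \<in> monk_covers r (swap_adjacent v i). ddiff i (schubert (swap_positions (swap_adjacent v i) (a, b))))
    = (\<Sum>(a, b) \<in> {(a, b). 1 \<le> a \<and> bruhat_cover v a b \<and> (a, b) \<noteq> (i, Suc i) \<and> s a \<le> r \<and> r < s b}.
        schubert (swap_positions v (a, b)))" (is "_ = sum ?f ?B")
proof -
  let ?w = "swap_adjacent v i"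
  have w: "is_perm ?w" by (rule is_perm_swap_positions) (use v i in auto)
  have s: "1 \<le> s a \<longleftrightarrow> 1 \<le> a" for a using i by (auto simp: s_def transpose_def)
  have ss: "s (s a) = a" for a by (simp add: s_def)
  let ?desc = "\<lambda>(a, b). swap_positions ?w (a, b) (Suc i) < swap_positions ?w (a, b) i"
  let ?D = "{p \<in> monk_covers r ?w. ?desc p}"
  have conj: "swap_adjacent (swap_positions ?w (s a, s b)) i = swap_positions v (a, b)" for a b
    by (auto simp: fun_eq_iff s_def transpose_def)
  have desc_iff: "?desc (s a, s b) \<longleftrightarrow> swap_positions v (a, b) i < swap_positions v (a, b) (Suc i)" for a b
    using fun_cong[OF conj[of a b], of i] fun_cong[OF conj[of a b], of "Suc i"] by simp
  have dd: "ddiff i (schubert (swap_positions ?w (a, b)))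
      = (if ?desc (a, b) then schubert (swap_adjacent (swap_positions ?w (a, b)) i) else 0)"
    if "(a, b) \<in> monk_covers r ?w" for a b
    using ddiff_schubert[OF is_perm_monk_cover[OF w that] i] by simp
  have "(\<Sum>(a, b) \<in> monk_covers r ?w. ddiff i (schubert (swap_positions ?w (a, b))))
      = (\<Sum>(a, b) \<in> ?D. schubert (swap_adjacent (swap_positions ?w (a, b)) i))"
  proof (rule sum.mono_neutral_cong_right)
    show "finite (monk_covers r ?w)" by (rule finite_monk_covers[OF w])
  qed (auto simp: dd split: if_splits)
  also have "\<dots> = sum ?f ?B"
  proof (rule sum.reindex_bij_witness[where i = "\<lambda>(a, b). (s a, s b)" and j = "\<lambda>(a, b). (s a, s b)"])
    fix p assume "p \<in> ?D"
    then obtain a b where p: "p = (s a, s b)" "(s a, s b) \<in> monk_covers r ?w" "?desc (s a, s b)"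
      by (metis (no_types, lifting) mem_Collect_eq ss surj_pair)
    then have cov: "1 \<le> s a" "s a \<le> r" "r < s b" "bruhat_cover ?w (s a) (s b)" by (auto simp: monk_covers_def)
    have ne: "(a, b) \<noteq> (i, Suc i)"
      using cov(2,3) by (auto simp: s_def)
    have lt: "a < b"
    proof (rule ccontr)
      assume "\<not> a < b"
      then have "a = Suc i" "b = i" using cov(2,3) by (auto simp: s_def transpose_def split: if_splits)
      then show False using cov(4) asc by (simp add: bruhat_cover_def s_def)
    qed
    have "bruhat_cover v a b"
      using bruhat_cover_lift[OF v asc lt ne] cov(4) p(3) desc_iff by (simp add: s_def)
    then show "(case p of (a, b) \<Rightarrow> (s a, s b)) \<in> ?B" using p(1) cov ne s by (simp add: ss)
    show "(case case p of (a, b) \<Rightarrow> (s a, s b) of (a, b) \<Rightarrow> (s a, s b)) = p" using p(1) by (simp add: ss)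
    show "?f (case p of (a, b) \<Rightarrow> (s a, s b)) = (case p of (a, b) \<Rightarrow> schubert (swap_adjacent (swap_positions ?w (a, b)) i))"
      unfolding p(1) prod.case conj ss ..
  next
    fix p assume "p \<in> ?B"
    then obtain a b where p: "p = (a, b)" "1 \<le> a" "bruhat_cover v a b" "(a, b) \<noteq> (i, Suc i)" "s a \<le> r" "r < s b" by blast
    have "a < b" using p(3) by (simp add: bruhat_cover_def)
    then have "bruhat_cover ?w (s a) (s b)" "?desc (s a, s b)"
      using bruhat_cover_lift[OF v asc _ p(4)] p(3) desc_iff by (auto simp: s_def)
    then show "(case p of (a, b) \<Rightarrow> (s a, s b)) \<in> ?D" using p s by (simp add: monk_covers_def)
    show "(case case p of (a, b) \<Rightarrow> (s a, s b) of (a, b) \<Rightarrow> (s a, s b)) = p" using p(1) by (simp add: ss)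
  qed
  finally show ?thesis .
qed

text \<open>Both sides have constant term \<open>0\<close>, so it is enough to compare their divided differences. For
  \<open>i \<noteq> r\<close> the variable sum is symmetric, and the lifting property reduces the claim to \<open>w s\<^sub>i\<close>. For
  \<open>i = r\<close> the Leibniz rule gives \<open>S w\<close> and \<open>x\<^sub>1 + \<dots> + x\<^bsub>r-1\<^esub> + x\<^bsub>r+1\<^esub>\<close> times \<open>S (w s\<^sub>r)\<close>; that factor is the
  combination \<open>var_sum (r - 1) + var_sum (r + 1) - var_sum r\<close>, to which the induction hypothesis applies.\<close>

theorem monk_formula:
  assumes "is_perm w"
  shows "var_sum r * schubert w = (\<Sum>(a, b) \<in> monk_covers r w. schubert (swap_positions w (a, b)))"
  using assms
proof (induction "perm_length w" arbitrary: w r rule: less_induct)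
  case (less w)
  note w = less.prems
  let ?R = "\<lambda>r w. \<Sum>(a, b) \<in> monk_covers r w. schubert (swap_positions w (a, b))"
  have "var_sum r * schubert w - ?R r w = 0"
  proof (rule symmetric_imp_zero)
    have "positive_vars (var_sum r)"
      unfolding var_sum_def by (intro positive_vars_sum positive_vars_X) simp
    then show "positive_vars (var_sum r * schubert w - ?R r w)"
      by (intro positive_vars_diff positive_vars_mult positive_vars_sum) (auto simp: positive_vars_schubert)
    have "const_term (schubert (swap_positions w (a, b))) = 0" if ab: "(a, b) \<in> monk_covers r w" for a b
    proof -
      have "a < b" "w a < w b" using ab by (auto simp: monk_covers_def bruhat_cover_def)
      then have "swap_positions w (a, b) b < swap_positions w (a, b) a" by simp
      then have "swap_positions w (a, b) \<noteq> id" using \<open>a < b\<close> by (metis id_apply less_asym)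
      then show ?thesis using const_term_schubert[OF is_perm_monk_cover[OF w ab]] by simp
    qed
    then have "const_term (?R r w) = 0"
      unfolding const_term_sum by (intro sum.neutral) auto
    then show "const_term (var_sum r * schubert w - ?R r w) = 0"
      by (simp add: const_term_diff const_term_mult const_term_sum var_sum_def)
  next
    fix i :: nat assume i: "1 \<le> i"
    have L: "ddiff i (var_sum r * schubert w) = (if i = r then schubert w else 0)
        + (if i = r then var_sum (r - 1) + var_sum (Suc r) - var_sum r else var_sum r) * ddiff i (schubert w)"
      using i by (simp add: ddiff_mult ddiff_var_sum swap_vars_var_sum)
    have R: "ddiff i (?R r w) = (\<Sum>(a, b) \<in> monk_covers r w. ddiff i (schubert (swap_positions w (a, b))))"
      by (simp add: ddiff_sum case_prod_unfold)
    have "ddiff i (var_sum r * schubert w) = ddiff i (?R r w)"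
    proof (cases "w (Suc i) < w i")
      case False
      then have asc: "w i < w (Suc i)" using is_perm_eq_iff[OF w, of i "Suc i"] by simp
      have zero: "ddiff i (schubert (swap_positions w (a, b))) = 0"
        if ab: "(a, b) \<in> monk_covers r w" "(a, b) \<noteq> (i, Suc i)" for a b
      proof -
        have "bruhat_cover w a b" "a < b" using ab by (auto simp: monk_covers_def bruhat_cover_def)
        then have "swap_positions w (a, b) i < swap_positions w (a, b) (Suc i)"
          using bruhat_cover_lift[OF w asc _ ab(2)] by blast
        then show ?thesis using ddiff_schubert[OF is_perm_monk_cover[OF w ab(1)] i] by simp
      qed
      have one: "ddiff i (schubert (swap_adjacent w i)) = schubert w"
        using ddiff_schubert[OF is_perm_swap_positions[OF w, of i "Suc i"] i] i asc by simp
      have "(\<Sum>(a, b) \<in> monk_covers r w. ddiff i (schubert (swap_positions w (a, b))))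
          = (\<Sum>p \<in> monk_covers r w. if p = (i, Suc i) then schubert w else 0)"
      proof (rule sum.cong[OF refl])
        fix p assume p: "p \<in> monk_covers r w"
        obtain a b where ab: "p = (a, b)" by fastforce
        show "(case p of (a, b) \<Rightarrow> ddiff i (schubert (swap_positions w (a, b)))) = (if p = (i, Suc i) then schubert w else 0)"
          using p zero[of a b] one unfolding ab by (cases "(a, b) = (i, Suc i)") auto
      qed
      also have "\<dots> = (if i = r then schubert w else 0)"
      proof -
        have "(i, Suc i) \<in> monk_covers r w \<longleftrightarrow> i = r"
          using i asc by (auto simp: monk_covers_def bruhat_cover_def)
        then show ?thesis using finite_monk_covers[OF w, of r] by (simp add: sum.delta')
      qed
      finally show ?thesis unfolding L R using ddiff_schubert[OF w i] False by simp
    next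
      case True
      define v where "v = swap_adjacent w i"
      have v: "is_perm v" unfolding v_def by (rule is_perm_swap_positions) (use w i in auto)
      have w_eq: "w = swap_adjacent v i" by (simp add: v_def)
      have asc: "v i < v (Suc i)" using True by (simp add: v_def)
      have IH: "var_sum r * schubert v = ?R r v" for r
        by (rule less.hyps[OF _ v]) (use perm_length_swap_descent[OF w i True] in \<open>simp add: v_def\<close>)
      let ?s = "Transposition.transpose i (Suc i)"
      let ?f = "\<lambda>(a, b). schubert (swap_positions v (a, b))"
      define B where "B = {(a, b). 1 \<le> a \<and> bruhat_cover v a b \<and> (a, b) \<noteq> (i, Suc i) \<and> ?s a \<le> r \<and> r < ?s b}"
      have R': "ddiff i (?R r w) = sum ?f B"
        using R sum_descents_of_covers[OF v i asc, of r] unfolding B_def w_eq[symmetric] by simp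
      have dw: "ddiff i (schubert w) = schubert v"
        using ddiff_schubert[OF w i] True by (simp add: v_def)
      have lt: "a < b" if "bruhat_cover v a b" for a b using that by (simp add: bruhat_cover_def)
      show ?thesis
      proof (cases "i = r")
        case False
        have "B = monk_covers r v"
          using False by (auto simp: B_def monk_covers_def transpose_def split: if_splits dest: lt)
        then show ?thesis unfolding L R' dw using False IH by simp
      next
        case True
        let ?C = "monk_covers r v - {(i, Suc i)}"
        have fin: "finite (monk_covers r v)" for r by (rule finite_monk_covers[OF v])
        \<comment> \<open>A cover with \<open>a < r\<close> and \<open>b > r + 1\<close> is counted twice on both sides, every other one at most once.\<close>
        have eqs: "monk_covers (r - 1) v \<union> monk_covers (Suc r) v = B \<union> ?C"
           "monk_covers (r - 1) v \<inter> monk_covers (Suc r) v = B \<inter> ?C"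
          using True by (auto simp: B_def monk_covers_def transpose_def split: if_splits dest: lt)
        have "finite B" using eqs(1) fin by (metis finite_Un)
        then have "sum ?f (monk_covers (r - 1) v) + sum ?f (monk_covers (Suc r) v) = sum ?f B + sum ?f ?C"
          using sum.union_inter[OF fin fin, of ?f "r - 1" "Suc r"] sum.union_inter[of B ?C ?f] fin eqs by simp
        moreover have "(i, Suc i) \<in> monk_covers r v"
          using True i asc by (auto simp: monk_covers_def bruhat_cover_def)
        then have "sum ?f (monk_covers r v) = schubert w + sum ?f ?C"
          using sum.remove[OF fin[of r], of "(i, Suc i)" ?f] by (simp add: w_eq)
        ultimately have "sum ?f B = schubert w + (?R (r - 1) v + ?R (Suc r) v - ?R r v)"
          by (simp add: algebra_simps)
        then show ?thesis unfolding L R' dw using True by (simp add: left_diff_distrib distrib_right IH)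
      qed
    qed
    then show "ddiff i (var_sum r * schubert w - ?R r w) = 0" by (simp add: ddiff_diff)
  qed
  then show ?case by simp
qed

text \<open>Induction on the distance \<open>b - a\<close>: the value at \<open>a + 1\<close> is not between \<open>w a\<close> and \<open>w b\<close>, and in both
  cases the lifting property at \<open>a\<close> yields a cover with a smaller distance.\<close>

lemma perm_length_cover:
  assumes "is_perm w" "1 \<le> a" "bruhat_cover w a b"
  shows "perm_length (swap_positions w (a, b)) = Suc (perm_length w)"
  using assms
proof (induction "b - a" arbitrary: a w rule: less_induct)
  case less
  note w = less.prems(1) and a = less.prems(2) and cov = less.prems(3)
  have "a < b" "w a < w b" using cov by (auto simp: bruhat_cover_def)
  show ?case
  proof (cases "b = Suc a")
    case True
    then show ?thesis using perm_length_swap_ascent[OF w a] \<open>w a < w b\<close> by simp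
  next
    case False
    then have b: "Suc a < b" using \<open>a < b\<close> by simp
    define w' where "w' = swap_adjacent w a"
    have w': "is_perm w'" unfolding w'_def by (rule is_perm_swap_positions) (use w a in auto)
    have conj: "swap_positions w' (Suc a, b) = swap_adjacent (swap_positions w (a, b)) a"
      using b by (auto simp: w'_def fun_eq_iff transpose_def)
    have wt: "is_perm (swap_positions w (a, b))" by (rule is_perm_swap_positions) (use w a b in auto)
    have wt': "is_perm (swap_positions w' (Suc a, b))" by (rule is_perm_swap_positions) (use w' b in auto)
    have IH: "perm_length (swap_positions w' (Suc a, b)) = Suc (perm_length w')" if "bruhat_cover w' (Suc a) b"
      by (rule less.hyps) (use w' that b in auto)
    show ?thesis
    proof (cases "w a < w (Suc a)")
      case True
      have "bruhat_cover w' (Suc a) b" "swap_positions w (a, b) a < swap_positions w (a, b) (Suc a)"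
        using bruhat_cover_lift[OF w True \<open>a < b\<close>] cov False b by (auto simp: w'_def transpose_apply_other)
      then show ?thesis
        using IH perm_length_swap_ascent[OF w a True] perm_length_swap_ascent[OF wt a] by (simp add: conj flip: w'_def)
    next
      case False
      then have desc: "w (Suc a) < w a" using is_perm_eq_iff[OF w, of a "Suc a"] by simp
      have eq: "swap_adjacent w' a = w" by (simp add: w'_def)
      have "bruhat_cover w' (Suc a) b"
        using bruhat_cover_lift[OF w', of a "Suc a" b] cov desc \<open>w a < w b\<close> b
        by (simp add: eq transpose_apply_other) (simp add: w'_def transpose_apply_other)
      moreover have "swap_positions w' (Suc a, b) a < swap_positions w' (Suc a, b) (Suc a)"
        using desc \<open>w a < w b\<close> b by (simp add: w'_def transpose_apply_other)
      then have "swap_positions w (a, b) (Suc a) < swap_positions w (a, b) a" by (simp add: conj)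
      ultimately show ?thesis
        using IH perm_length_swap_descent[OF w a desc] perm_length_swap_descent[OF wt a] by (simp add: conj flip: w'_def)
    qed
  qed
qed

section \<open>Expansions into Schubert polynomials\<close>

definition expansion :: "ipoly \<Rightarrow> ((nat \<Rightarrow> nat) \<Rightarrow> int) \<Rightarrow> bool" where
  "expansion f c \<longleftrightarrow> finite {w. c w \<noteq> 0} \<and> (\<forall>w. c w \<noteq> 0 \<longrightarrow> is_perm w) \<and>
     f = (\<Sum>w \<in> {w. c w \<noteq> 0}. of_int (c w) * schubert w)"

lemma expansionI:
  assumes "finite A" "\<And>w. w \<in> A \<Longrightarrow> is_perm w" "\<And>w. w \<notin> A \<Longrightarrow> c w = 0"
    "f = (\<Sum>w\<in>A. of_int (c w) * schubert w)"
  shows "expansion f c"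
proof -
  have sub: "{w. c w \<noteq> 0} \<subseteq> A" using assms(3) by auto
  then have "(\<Sum>w\<in>A. of_int (c w) * schubert w) = (\<Sum>w \<in> {w. c w \<noteq> 0}. of_int (c w) * schubert w)"
    by (intro sum.mono_neutral_right) (use assms in auto)
  then show ?thesis using sub assms finite_subset[OF sub] unfolding expansion_def by auto
qed

lemma expansion_superset:
  assumes "expansion f c" "finite A" "{w. c w \<noteq> 0} \<subseteq> A"
  shows "f = (\<Sum>w\<in>A. of_int (c w) * schubert w)"
proof -
  have "(\<Sum>w\<in>A. of_int (c w) * schubert w) = (\<Sum>w \<in> {w. c w \<noteq> 0}. of_int (c w) * schubert w)"
    by (rule sum.mono_neutral_right) (use assms in auto)
  then show ?thesis using assms(1) by (simp add: expansion_def)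
qed

lemma expansion_linear:
  assumes f: "expansion f c" and g: "expansion g d"
  shows "expansion (f + of_int k * g) (\<lambda>w. c w + k * d w)"
proof (rule expansionI)
  let ?A = "{w. c w \<noteq> 0} \<union> {w. d w \<noteq> 0}"
  show fin: "finite ?A" using f g by (auto simp: expansion_def)
  show "\<And>w. w \<in> ?A \<Longrightarrow> is_perm w" using f g by (auto simp: expansion_def)
  have "f = (\<Sum>w\<in>?A. of_int (c w) * schubert w)" by (rule expansion_superset[OF f fin]) auto
  moreover have "g = (\<Sum>w\<in>?A. of_int (d w) * schubert w)" by (rule expansion_superset[OF g fin]) auto
  ultimately show "f + of_int k * g = (\<Sum>w\<in>?A. of_int (c w + k * d w) * schubert w)"
    by (simp add: sum.distrib sum_distrib_left distrib_right mult.assoc)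
qed auto

lemma expansion_add: "expansion f c \<Longrightarrow> expansion g d \<Longrightarrow> expansion (f + g) (\<lambda>w. c w + d w)"
  using expansion_linear[of f c g d 1] by simp

lemma expansion_diff: "expansion f c \<Longrightarrow> expansion g d \<Longrightarrow> expansion (f - g) (\<lambda>w. c w - d w)"
  using expansion_linear[of f c g d "-1"] by simp

lemma expansion_zero: "expansion 0 (\<lambda>w. 0)"
  by (simp add: expansion_def)

lemma expansion_scale: "expansion f c \<Longrightarrow> expansion (of_int k * f) (\<lambda>w. k * c w)"
  using expansion_linear[OF expansion_zero, of f c k] by simp

lemma expansion_schubert: "is_perm w \<Longrightarrow> expansion (schubert w) (\<lambda>v. if v = w then 1 else 0)"
  by (rule expansionI[where A = "{w}"]) auto

lemma expansion_sum:
  "(\<And>a. a \<in> A \<Longrightarrow> expansion (f a) (c a)) \<Longrightarrow> expansion (\<Sum>a\<in>A. f a) (\<lambda>w. \<Sum>a\<in>A. c a w)"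
  by (induction A rule: infinite_finite_induct) (simp_all add: expansion_zero expansion_add)

lemma expansion_const_term:
  assumes "expansion f c" shows "c id = const_term f"
proof -
  let ?A = "insert id {w. c w \<noteq> 0}"
  have fin: "finite ?A" and perm: "\<And>w. w \<in> ?A \<Longrightarrow> is_perm w" using assms by (auto simp: expansion_def)
  have "const_term f = (\<Sum>w\<in>?A. c w * const_term (schubert w))"
    unfolding expansion_superset[OF assms fin subset_insertI] by (simp add: const_term_sum const_term_mult)
  also have "\<dots> = (\<Sum>w\<in>?A. if w = id then c w else 0)"
    by (rule sum.cong) (use perm in \<open>auto simp: const_term_schubert\<close>)
  also have "\<dots> = c id" using fin by (simp add: sum.delta)
  finally show ?thesis by simp
qed

lemma expansion_ddiff:
  assumes f: "expansion f c" and i: "1 \<le> i"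
  shows "expansion (ddiff i f) (\<lambda>v. if v i < v (Suc i) then c (swap_adjacent v i) else 0)"
proof -
  let ?A = "{w. c w \<noteq> 0}" and ?D = "{w. c w \<noteq> 0 \<and> w (Suc i) < w i}"
  let ?s = "\<lambda>w. swap_adjacent w i"
  have fin: "finite ?A" and perm: "\<And>w. w \<in> ?A \<Longrightarrow> is_perm w"
    and f_eq: "f = (\<Sum>w\<in>?A. of_int (c w) * schubert w)" using f by (auto simp: expansion_def)
  have inj: "inj_on ?s ?D" by (rule inj_onI) (simp add: swap_adjacent_inject)
  show ?thesis
  proof (rule expansionI)
    show "finite (?s ` ?D)" using fin by (auto intro: finite_subset[OF _ fin])
    show "is_perm w" if "w \<in> ?s ` ?D" for w
      using that perm i by (auto intro!: is_perm_swap_positions)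
    show "(if v i < v (Suc i) then c (?s v) else 0) = 0" if "v \<notin> ?s ` ?D" for v
    proof (rule ccontr)
      assume "\<not> ?thesis"
      then have "?s v \<in> ?D" by (auto split: if_splits)
      then have "?s (?s v) \<in> ?s ` ?D" by (rule imageI)
      then show False using that by simp
    qed
    have "ddiff i f = (\<Sum>w\<in>?A. of_int (c w) * ddiff i (schubert w))"
      unfolding arg_cong[OF f_eq, of "ddiff i"] by (simp add: ddiff_sum ddiff_mult)
    also have "\<dots> = (\<Sum>w\<in>?D. of_int (c w) * schubert (?s w))"
      by (rule sum.mono_neutral_cong_right) (use fin perm i in \<open>auto simp: ddiff_schubert\<close>)
    also have "\<dots> = (\<Sum>v\<in>?s ` ?D. of_int (if v i < v (Suc i) then c (?s v) else 0) * schubert v)"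
      unfolding sum.reindex[OF inj] by (rule sum.cong) auto
    finally show "ddiff i f = \<dots>" .
  qed
qed

text \<open>A divided difference at a descent \<open>i\<close> of \<open>z\<close> moves the coefficient at \<open>z\<close> to the shorter permutation
  \<open>z s\<^sub>i\<close>, until it can be read off as a constant term.\<close>

theorem expansion_unique:
  assumes "expansion f c" "expansion f d" shows "c = d"
proof -
  have "\<forall>f c d. expansion f c \<longrightarrow> expansion f d \<longrightarrow> c z = d z" if "is_perm z" for z
    using that
  proof (induction "perm_length z" arbitrary: z rule: less_induct)
    case less
    show ?case
    proof (cases "z = id")
      case True
      then show ?thesis using expansion_const_term by metis
    next
      case False
      then obtain i where i: "1 \<le> i" "z (Suc i) < z i" using perm_descent_exists less.prems by blast
      have z': "is_perm (swap_adjacent z i)" by (rule is_perm_swap_positions) (use less.prems i in auto)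
      have len: "perm_length (swap_adjacent z i) < perm_length z"
        using perm_length_swap_descent[OF less.prems i] by simp
      define lower where "lower c v = (if v i < v (Suc i) then c (swap_adjacent v i) else 0)"
        for c :: "(nat \<Rightarrow> nat) \<Rightarrow> int" and v
      have lower: "expansion (ddiff i f) (lower c)" if "expansion f c" for f c
        using expansion_ddiff[OF that i(1)] by (simp add: lower_def[abs_def])
      have at: "lower c (swap_adjacent z i) = c z" for c
        using i by (simp add: lower_def)
      show ?thesis
      proof (intro allI impI)
        fix f c d assume "expansion f c" "expansion f d"
        then have "lower c (swap_adjacent z i) = lower d (swap_adjacent z i)"
          using less.hyps[OF len z'] lower by blast
        then show "c z = d z" unfolding at .
      qed
    qed
  qed
  then have "c z = d z" if "is_perm z" for z using that assms by blast
  moreover have "c z = d z" if "\<not> is_perm z" for z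
    using that assms unfolding expansion_def by metis
  ultimately show ?thesis by (metis ext)
qed

lemma schubert_coeff_eq:
  assumes "expansion (schubert u * schubert v) c"
  shows "schubert_coeff u v = c"
proof -
  have "schubert_coeff u v = (THE c. expansion (schubert u * schubert v) c)"
    by (simp add: schubert_coeff_def expansion_def)
  then show ?thesis using assms expansion_unique by (metis the_equality)
qed

definition expandable :: "ipoly \<Rightarrow> bool" where
  "expandable f \<longleftrightarrow> (\<exists>c. expansion f c)"

definition schubert_positive :: "ipoly \<Rightarrow> bool" where
  "schubert_positive f \<longleftrightarrow> (\<exists>c. expansion f c \<and> (\<forall>w. 0 \<le> c w))"

lemma schubert_positive_expandable: "schubert_positive f \<Longrightarrow> expandable f"
  by (auto simp: schubert_positive_def expandable_def)

lemma schubert_positive_coeff: "schubert_positive f \<Longrightarrow> expansion f c \<Longrightarrow> 0 \<le> c w"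
  using expansion_unique by (auto simp: schubert_positive_def)

lemma expandable_add: "expandable f \<Longrightarrow> expandable g \<Longrightarrow> expandable (f + g)"
  unfolding expandable_def using expansion_add by blast

lemma expandable_diff: "expandable f \<Longrightarrow> expandable g \<Longrightarrow> expandable (f - g)"
  unfolding expandable_def using expansion_diff by blast

lemma expandable_zero: "expandable 0"
  unfolding expandable_def using expansion_zero by blast

lemma expandable_sum: "(\<And>a. a \<in> A \<Longrightarrow> expandable (f a)) \<Longrightarrow> expandable (\<Sum>a\<in>A. f a)"
  by (induction A rule: infinite_finite_induct) (simp_all add: expandable_zero expandable_add)

lemma schubert_positiveI: "expansion f c \<Longrightarrow> (\<And>w. 0 \<le> c w) \<Longrightarrow> schubert_positive f"
  by (auto simp: schubert_positive_def)

lemma schubert_positive_zero: "schubert_positive 0"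
  by (rule schubert_positiveI[OF expansion_zero]) simp

lemma schubert_positive_add: "schubert_positive f \<Longrightarrow> schubert_positive g \<Longrightarrow> schubert_positive (f + g)"
  by (auto simp: schubert_positive_def[of f] schubert_positive_def[of g]
      intro: schubert_positiveI[OF expansion_add])

lemma schubert_positive_scale:
  assumes "schubert_positive f" "0 \<le> k" shows "schubert_positive (of_int k * f)"
proof -
  obtain c where "expansion f c" "\<forall>w. 0 \<le> c w" using assms(1) by (auto simp: schubert_positive_def)
  then show ?thesis using assms(2) by (intro schubert_positiveI[OF expansion_scale[of f c]]) auto
qed

lemma schubert_positive_sum:
  "(\<And>a. a \<in> A \<Longrightarrow> schubert_positive (f a)) \<Longrightarrow> schubert_positive (\<Sum>a\<in>A. f a)"
  by (induction A rule: infinite_finite_induct) (simp_all add: schubert_positive_zero schubert_positive_add)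

lemma schubert_positive_schubert: "is_perm w \<Longrightarrow> schubert_positive (schubert w)"
  by (rule schubert_positiveI[OF expansion_schubert]) auto

lemma schubert_positive_mult:
  assumes g: "\<And>w. is_perm w \<Longrightarrow> schubert_positive (g * schubert w)" and f: "schubert_positive f"
  shows "schubert_positive (g * f)"
proof -
  obtain c where c: "expansion f c" "\<forall>w. 0 \<le> c w" using f by (auto simp: schubert_positive_def)
  have "g * f = (\<Sum>w \<in> {w. c w \<noteq> 0}. of_int (c w) * (g * schubert w))"
    using c(1) by (simp add: expansion_def sum_distrib_left algebra_simps)
  then show ?thesis using c g
    by (auto simp: expansion_def intro!: schubert_positive_sum schubert_positive_scale)
qed

lemma expandable_mult:
  assumes g: "\<And>w. is_perm w \<Longrightarrow> expandable (g * schubert w)" and f: "expandable f"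
  shows "expandable (g * f)"
proof -
  obtain c where c: "expansion f c" using f by (auto simp: expandable_def)
  have "expandable (of_int k * h)" if "expandable h" for k h
    using that expansion_scale unfolding expandable_def by blast
  moreover have "g * f = (\<Sum>w \<in> {w. c w \<noteq> 0}. of_int (c w) * (g * schubert w))"
    using c(1) by (simp add: expansion_def sum_distrib_left algebra_simps)
  ultimately show ?thesis using c g
    by (auto simp: expansion_def intro!: expandable_sum)
qed

lemma schubert_positive_ddiff:
  assumes "schubert_positive f" "1 \<le> i" shows "schubert_positive (ddiff i f)"
proof -
  obtain c where "expansion f c" "\<forall>w. 0 \<le> c w" using assms(1) by (auto simp: schubert_positive_def)
  then show ?thesis using assms(2) by (intro schubert_positiveI[OF expansion_ddiff[of f c]]) auto
qed

lemma schubert_positive_var_sum: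
  assumes "schubert_positive f" shows "schubert_positive (var_sum r * f)"
proof (rule schubert_positive_mult[OF _ assms])
  fix w assume "is_perm w"
  then show "schubert_positive (var_sum r * schubert w)"
    by (auto simp: monk_formula intro!: schubert_positive_sum schubert_positive_schubert is_perm_monk_cover)
qed

lemma expandable_X_mult:
  assumes "expandable f" "1 \<le> r" shows "expandable (X r * f)"
proof -
  have "expandable (var_sum r * f)" for r
    by (rule expandable_mult[OF _ assms(1)])
       (meson schubert_positive_expandable schubert_positive_schubert schubert_positive_var_sum)
  moreover have "X r * f = var_sum r * f - var_sum (r - 1) * f"
    using assms(2) by (cases r) (auto simp: var_sum_Suc algebra_simps)
  ultimately show ?thesis using expandable_diff by simp
qed

section \<open>Positivity of products with monomials\<close>

definition squarefree_monomial :: "nat set \<Rightarrow> ipoly" where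
  "squarefree_monomial I = (\<Prod>i\<in>I. X i)"

lemma expandable_squarefree_monomial:
  assumes "finite I" "0 \<notin> I" "expandable f" shows "expandable (squarefree_monomial I * f)"
  using assms
  by (induction I) (auto simp: squarefree_monomial_def mult.assoc intro!: expandable_X_mult)

lemma swap_vars_squarefree_monomial:
  "swap_vars i (squarefree_monomial I) = squarefree_monomial (Transposition.transpose i (Suc i) ` I)"
  unfolding squarefree_monomial_def swap_vars_prod swap_vars_X
  by (simp add: prod.reindex[OF inj_on_subset[OF inj_transpose subset_UNIV]])

lemma ddiff_squarefree_monomial_same:
  assumes "i \<in> I \<longleftrightarrow> Suc i \<in> I"
  shows "ddiff i (squarefree_monomial I * f) = squarefree_monomial I * ddiff i f"
proof -
  have "Transposition.transpose i (Suc i) ` I = I"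
    using assms by (simp add: transpose_image_eq)
  then have "swap_vars i (squarefree_monomial I) = squarefree_monomial I"
    by (simp add: swap_vars_squarefree_monomial)
  then show ?thesis by (simp add: ddiff_mult ddiff_symmetric)
qed

lemma ddiff_squarefree_monomial_left:
  assumes "finite I" "i \<in> I" "Suc i \<notin> I"
  shows "ddiff i (squarefree_monomial I * f)
    = squarefree_monomial (I - {i}) * f + squarefree_monomial (insert (Suc i) (I - {i})) * ddiff i f"
proof -
  let ?m = "squarefree_monomial (I - {i})"
  have m: "squarefree_monomial I = X i * ?m" "squarefree_monomial (insert (Suc i) (I - {i})) = X (Suc i) * ?m"
    using assms by (simp_all add: squarefree_monomial_def prod.remove)
  have "Transposition.transpose i (Suc i) ` (I - {i}) = I - {i}"
    using assms by (simp add: transpose_image_eq)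
  then have "swap_vars i ?m = ?m" by (simp add: swap_vars_squarefree_monomial)
  then show ?thesis unfolding m by (simp add: ddiff_mult ddiff_symmetric ddiff_X swap_vars_mult swap_vars_X)
qed

text \<open>The invariant that controls the signs below: if some position before \<open>c \<in> I\<close> is missing in \<open>I\<close>, then
  \<open>z\<close> has a left-to-right maximum at \<open>c\<close>. Initial segments \<open>I = {1..j}\<close> have no gaps, so every \<open>z\<close>
  satisfies it for them.\<close>

definition records_after_gap :: "nat set \<Rightarrow> (nat \<Rightarrow> nat) \<Rightarrow> bool" where
  "records_after_gap I z \<longleftrightarrow>
     (\<forall>c\<in>I. (\<exists>d. 1 \<le> d \<and> d < c \<and> d \<notin> I) \<longrightarrow> (\<forall>e. 1 \<le> e \<and> e < c \<longrightarrow> z e < z c))"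

text \<open>Remove descents of \<open>z\<close> by divided differences. For a descent \<open>i\<close>, the Leibniz rule gives
  \<open>\<partial>\<^sub>i (x\<^sub>I f)\<close> as \<open>x\<^sub>I \<partial>\<^sub>i f\<close> if \<open>i\<close> and \<open>i + 1\<close> are both in \<open>I\<close> or both outside, as the sum of \<open>x\<^sub>J f\<close> and
  \<open>x\<^sub>K \<partial>\<^sub>i f\<close> with \<open>J = I - {i}\<close> and \<open>K = J \<union> {i + 1}\<close> if only \<open>i\<close> is in \<open>I\<close>, and with a negative term if
  only \<open>i + 1\<close> is in \<open>I\<close>. The last case is impossible by the invariant. The invariant passes on to \<open>I\<close>, \<open>J\<close> and \<open>K\<close>
  and \<open>z s\<^sub>i\<close>. For \<open>K\<close> this needs that \<open>i\<close> is the first descent of \<open>z\<close>: then \<open>z i\<close> exceeds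
  all earlier values, and it is the value of \<open>z s\<^sub>i\<close> at \<open>i + 1\<close>.\<close>

lemma squarefree_monomial_coeff_nonneg:
  assumes "is_perm z"
  shows "\<forall>I f c. finite I \<longrightarrow> 0 \<notin> I \<longrightarrow> records_after_gap I z \<longrightarrow> schubert_positive f \<longrightarrow>
    expansion (squarefree_monomial I * f) c \<longrightarrow> 0 \<le> c z"
  using assms
proof (induction "perm_length z" arbitrary: z rule: less_induct)
  case less
  note z = less.prems
  show ?case
  proof (intro allI impI, cases "z = id")
    fix I f c
    assume I: "finite I" "0 \<notin> I" and gap: "records_after_gap I z" and f: "schubert_positive f"
      and c: "expansion (squarefree_monomial I * f) c"
    case True
    obtain d where d: "expansion f d" "0 \<le> d id" using f by (auto simp: schubert_positive_def)
    have "const_term (squarefree_monomial I) = (if I = {} then 1 else 0)"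
      using I(1) by (induction I) (auto simp: squarefree_monomial_def const_term_mult)
    then show "0 \<le> c z" using expansion_const_term[OF c] expansion_const_term[OF d(1)] d(2)
      by (simp add: True const_term_mult)
  next
    fix I f c
    assume I: "finite I" "0 \<notin> I" and gap: "records_after_gap I z" and f: "schubert_positive f"
      and c: "expansion (squarefree_monomial I * f) c"
    case False
    define i where "i = (LEAST i. 1 \<le> i \<and> z (Suc i) < z i)"
    have "1 \<le> i \<and> z (Suc i) < z i"
      unfolding i_def by (rule LeastI_ex) (use perm_descent_exists[OF z False] in blast)
    then have i: "1 \<le> i" "z (Suc i) < z i" by auto
    have asc: "z j < z (Suc j)" if "1 \<le> j" "j < i" for j
      using not_less_Least[OF that(2)[unfolded i_def]] that(1) is_perm_eq_iff[OF z, of j "Suc j"] by auto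
    have incr: "z e < z i" if "1 \<le> e" "e < i" for e
    proof -
      have "z e < z m" if "e < m" "m \<le> i" for m
        using that \<open>1 \<le> e\<close>
      proof (induction m)
        case (Suc m)
        then show ?case using asc[of m] by (cases "e = m") auto
      qed simp
      then show ?thesis using \<open>e < i\<close> by blast
    qed
    let ?z = "swap_adjacent z i"
    have z': "is_perm ?z" by (rule is_perm_swap_positions) (use z i in auto)
    have len: "perm_length ?z < perm_length z" using perm_length_swap_descent[OF z i] by simp
    have ddiff_pos: "schubert_positive (ddiff i f)" by (rule schubert_positive_ddiff[OF f i(1)])
    define c' where "c' = (\<lambda>v. if v i < v (Suc i) then c (swap_adjacent v i) else 0)"
    have c': "expansion (ddiff i (squarefree_monomial I * f)) c'" "c' ?z = c z"
      using expansion_ddiff[OF c i(1)] i(2) by (simp_all add: c'_def)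
    have gapD: "z e < z c" if "c \<in> I" "1 \<le> d" "d < c" "d \<notin> I" "1 \<le> e" "e < c" for c d e
      using gap that unfolding records_after_gap_def by blast
    have same_prefix: "?z e < ?z c" if "c \<noteq> i" "c \<noteq> Suc i" "1 \<le> e" "e < c" "\<And>e. 1 \<le> e \<Longrightarrow> e < c \<Longrightarrow> z e < z c" for c e
      using that i(1) by (auto simp: transpose_def)
    consider "i \<in> I \<longleftrightarrow> Suc i \<in> I" | "i \<in> I" "Suc i \<notin> I" | "i \<notin> I" "Suc i \<in> I" by blast
    then show "0 \<le> c z"
    proof cases
      case 1
      have "records_after_gap I ?z"
        unfolding records_after_gap_def
      proof (intro ballI impI allI)
        fix c e assume cI: "c \<in> I" and "\<exists>d. 1 \<le> d \<and> d < c \<and> d \<notin> I" and e: "1 \<le> e \<and> e < c"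
        then obtain d where d: "1 \<le> d" "d < c" "d \<notin> I" by blast
        have rec: "z e < z c" if "1 \<le> e" "e < c" for e by (rule gapD[OF cI d that])
        have "c \<noteq> Suc i"
          using rec[of i] i by auto
        moreover have "c \<noteq> i"
        proof
          assume "c = i"
          then have "Suc i \<in> I" "d < Suc i" using 1 cI d by auto
          then show False using gapD[of "Suc i" d i] d i by simp
        qed
        ultimately show "?z e < ?z c" using same_prefix rec e by blast
      qed
      then show ?thesis
        using less.hyps[OF len z'] I ddiff_pos c' unfolding ddiff_squarefree_monomial_same[OF 1] by metis
    next
      case 2
      let ?J = "I - {i}" and ?K = "insert (Suc i) (I - {i})"
      have fin: "finite ?J" "0 \<notin> ?J" "finite ?K" "0 \<notin> ?K" using I by auto
      have gap_ex: "\<exists>d. 1 \<le> d \<and> d < c \<and> d \<notin> I"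
        if "1 \<le> d" "d < c" "d \<notin> ?J" "c \<noteq> Suc i" for c d
      proof (cases "d = i")
        case True
        then show ?thesis using that 2 by (intro exI[of _ "Suc i"]) auto
      qed (use that in blast)
      have J: "records_after_gap ?J ?z"
        unfolding records_after_gap_def
      proof (intro ballI impI allI)
        fix c e assume cI: "c \<in> ?J" and "\<exists>d. 1 \<le> d \<and> d < c \<and> d \<notin> ?J" and e: "1 \<le> e \<and> e < c"
        then obtain d where d: "1 \<le> d" "d < c" "d \<notin> ?J" by blast
        have ne: "c \<noteq> i" "c \<noteq> Suc i" using cI 2 by auto
        have "\<exists>d. 1 \<le> d \<and> d < c \<and> d \<notin> I"
          using d ne by (intro gap_ex) auto
        then have rec: "z e < z c" if "1 \<le> e" "e < c" for e using gapD cI that by blast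
        show "?z e < ?z c" using same_prefix ne rec e by blast
      qed
      have K: "records_after_gap ?K ?z"
        unfolding records_after_gap_def
      proof (intro ballI impI allI)
        fix c e assume cI: "c \<in> ?K" and "\<exists>d. 1 \<le> d \<and> d < c \<and> d \<notin> ?K" and e: "1 \<le> e \<and> e < c"
        then obtain d where d: "1 \<le> d" "d < c" "d \<notin> ?K" by blast
        show "?z e < ?z c"
        proof (cases "c = Suc i")
          case True
          then show ?thesis using e incr[of e] i by (cases "e = i") (auto simp: transpose_apply_other)
        next
          case False
          then have ne: "c \<noteq> i" "c \<noteq> Suc i" "c \<in> I" using cI 2 by auto
          have "\<exists>d. 1 \<le> d \<and> d < c \<and> d \<notin> I"
            using d ne by (intro gap_ex) auto
          then have rec: "z e < z c" if "1 \<le> e" "e < c" for e using gapD ne that by blast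
          show ?thesis using same_prefix ne rec e by blast
        qed
      qed
      obtain c1 where c1: "expansion (squarefree_monomial ?J * f) c1"
        using expandable_squarefree_monomial[OF fin(1,2) schubert_positive_expandable[OF f]] by (auto simp: expandable_def)
      obtain c2 where c2: "expansion (squarefree_monomial ?K * ddiff i f) c2"
        using expandable_squarefree_monomial[OF fin(3,4) schubert_positive_expandable[OF ddiff_pos]] by (auto simp: expandable_def)
      have "c' = (\<lambda>w. c1 w + c2 w)"
        using expansion_unique[OF c'(1)] expansion_add[OF c1 c2] by (simp add: ddiff_squarefree_monomial_left[OF I(1) 2])
      moreover have "0 \<le> c1 ?z" using less.hyps[OF len z'] fin(1,2) J f c1 by blast
      moreover have "0 \<le> c2 ?z" using less.hyps[OF len z'] fin(3,4) K ddiff_pos c2 by blast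
      ultimately show ?thesis using c'(2) by simp
    next
      case 3
      then have "z i < z (Suc i)" using gapD[of "Suc i" i i] i by simp
      then show ?thesis using i by simp
    qed
  qed
qed

lemma schubert_positive_initial_monomial:
  assumes "schubert_positive f" shows "schubert_positive (squarefree_monomial {1..j} * f)"
proof -
  have fin: "finite {1..j}" "0 \<notin> {1..j}" by auto
  obtain c where c: "expansion (squarefree_monomial {1..j} * f) c"
    using expandable_squarefree_monomial[OF fin schubert_positive_expandable[OF assms]] by (auto simp: expandable_def)
  have "0 \<le> c z" for z
  proof (cases "is_perm z")
    case True
    have "records_after_gap {1..j} z" by (auto simp: records_after_gap_def)
    then show ?thesis using squarefree_monomial_coeff_nonneg[OF True] fin assms c by blast
  next
    case False
    then have "c z = 0" using c by (auto simp: expansion_def)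
    then show ?thesis by simp
  qed
  then show ?thesis using c by (auto simp: schubert_positive_def)
qed

text \<open>Such a monomial is \<open>x\<^sub>1 \<cdots> x\<^sub>j\<close>, for the last \<open>j\<close> with a nonzero exponent, times a monomial of the same kind.\<close>

lemma schubert_positive_dominant_monomial:
  assumes "schubert_positive f" "\<And>i j. 1 \<le> i \<Longrightarrow> i \<le> j \<Longrightarrow> j \<le> k \<Longrightarrow> e j \<le> (e i :: nat)"
  shows "schubert_positive ((\<Prod>i=1..k. X i ^ e i) * f)"
  using assms(2)
proof (induction "\<Sum>i=1..k. e i" arbitrary: e rule: less_induct)
  case less
  show ?case
  proof (cases "\<forall>i\<in>{1..k}. e i = 0")
    case True
    then show ?thesis using assms(1) by (simp add: prod.neutral)
  next
    case False
    define j where "j = Max {i \<in> {1..k}. e i \<noteq> 0}"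
    have j: "j \<in> {i \<in> {1..k}. e i \<noteq> 0}" unfolding j_def by (rule Max_in) (use False in auto)
    have above: "e i = 0" if "j < i" "i \<le> k" for i
    proof (rule ccontr)
      assume "e i \<noteq> 0"
      then have "i \<le> j" unfolding j_def by (intro Max_ge) (use that in auto)
      then show False using that by simp
    qed
    have below: "e i \<noteq> 0" if "1 \<le> i" "i \<le> j" for i
      using less.prems[of i j] that j by auto
    define d where "d i = e i - (if i \<le> j then 1 else 0)" for i
    have "(\<Prod>i=1..k. X i ^ e i) = (\<Prod>i=1..k. (if i \<le> j then X i else 1) * X i ^ d i)"
    proof (rule prod.cong[OF refl])
      fix i assume "i \<in> {1..k}"
      then show "X i ^ e i = (if i \<le> j then X i else 1) * X i ^ d i"
        using below[of i] by (cases "e i") (auto simp: d_def)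
    qed
    also have "\<dots> = (\<Prod>i=1..k. if i \<le> j then X i else 1) * (\<Prod>i=1..k. X i ^ d i)"
      by (rule prod.distrib)
    also have "(\<Prod>i=1..k. if i \<le> j then X i else 1) = squarefree_monomial {1..j}"
      unfolding squarefree_monomial_def by (rule prod.mono_neutral_cong_right) (use j in auto)
    finally have eq: "(\<Prod>i=1..k. X i ^ e i) * f = squarefree_monomial {1..j} * ((\<Prod>i=1..k. X i ^ d i) * f)"
      by (simp add: mult.assoc)
    have "schubert_positive ((\<Prod>i=1..k. X i ^ d i) * f)"
    proof (rule less.hyps)
      show "(\<Sum>i=1..k. d i) < (\<Sum>i=1..k. e i)"
        by (rule sum_strict_mono_ex1) (use j in \<open>auto simp: d_def intro!: bexI[of _ j]\<close>)
      show "d i' \<le> d i" if "1 \<le> i" "i \<le> i'" "i' \<le> k" for i i'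
        using less.prems[OF that] above[of i'] that by (cases "i' \<le> j") (auto simp: d_def)
    qed
    then show ?thesis unfolding eq by (rule schubert_positive_initial_monomial)
  qed
qed

section \<open>Products with Grassmannian Schubert polynomials\<close>

definition ascends_after :: "nat \<Rightarrow> (nat \<Rightarrow> nat) \<Rightarrow> bool" where
  "ascends_after k u \<longleftrightarrow> (\<forall>i>k. u i < u (Suc i))"

lemma ascends_after_mono:
  assumes "ascends_after k u" "k < i" "i < j" shows "u i < u j"
  using assms(3)
proof (induction j)
  case (Suc j)
  then show ?case using assms(1,2) unfolding ascends_after_def
    by (metis less_Suc_eq less_trans)
qed simp

text \<open>Subtracting two instances of Monk's formula gives the product of \<open>x\<^sub>k\<close> with \<open>S w\<close>, as the difference of
  the covers that move position \<open>k\<close> to the right and those that move it to the left. If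
  \<open>w k\<close> is smaller than all earlier entries, there is none of the second sort. If \<open>w\<close> increases after \<open>k\<close> and
  \<open>w k + 1\<close> occurs there, then the only one of the first sort raises \<open>w k\<close> to \<open>w k + 1\<close>.\<close>

lemma schubert_lower_last_descending:
  assumes u: "is_perm u" and k: "1 \<le> k" and dec: "\<And>i. 1 \<le> i \<Longrightarrow> i < k \<Longrightarrow> u k < u i"
    and after: "ascends_after k u" and b: "k < b" "Suc (u b) = u k"
  defines "w \<equiv> swap_positions u (k, b)"
  shows "schubert u = X k * schubert w" and "is_perm w" and "ascends_after k w"
proof -
  show w: "is_perm w" unfolding w_def by (rule is_perm_swap_positions) (use u k b in auto)
  have w_k: "w k = u b" and w_b: "w b = u k" and w_other: "\<And>i. i \<noteq> k \<Longrightarrow> i \<noteq> b \<Longrightarrow> w i = u i"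
    by (auto simp: w_def transpose_apply_other)
  show after': "ascends_after k w"
    unfolding ascends_after_def
  proof (intro allI impI)
    fix i assume i: "k < i"
    then have "u i < u (Suc i)" using after by (simp add: ascends_after_def)
    moreover have "u (Suc i) \<noteq> u k" using is_perm_eq_iff[OF u, of "Suc i" k] i by simp
    ultimately show "w i < w (Suc i)"
      using i b w_b w_other[of i] w_other[of "Suc i"] by (cases "i = b"; cases "Suc i = b") auto
  qed
  have below: "monk_covers (k - 1) w = {(a, b'). 1 \<le> a \<and> a < k \<and> k < b' \<and> bruhat_cover w a b'}"
  proof -
    have not_k: "\<not> bruhat_cover w a k" if "1 \<le> a" "a < k" for a
      using dec[OF that] that b w_k w_other[of a] by (simp add: bruhat_cover_def)
    have arith: "a \<le> k - 1 \<longleftrightarrow> a < k" "k - 1 < b' \<longleftrightarrow> k < b' \<or> b' = k" for a b'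
      using k by auto
    show ?thesis unfolding monk_covers_def arith using not_k by auto
  qed
  have cover: "bruhat_cover w k b"
    using b w_k w_b by (auto simp: bruhat_cover_def)
  have only: "b' = b" if "k < b'" "bruhat_cover w k b'" for b'
  proof (rule ccontr)
    assume ne: "b' \<noteq> b"
    have "w k < w b'" using that by (simp add: bruhat_cover_def)
    then have "w b < w b'"
      using b w_k w_b is_perm_eq_iff[OF w, of b b'] ne by auto
    then have "b < b'" using ascends_after_mono[OF after' that(1), of b] ne by (metis linorder_neqE_nat less_asym)
    then show False using that(2) \<open>w b < w b'\<close> b w_k w_b unfolding bruhat_cover_def by (metis lessI)
  qed
  have "monk_covers k w = insert (k, b) (monk_covers (k - 1) w)"
  proof -
    have at_k: "k < b' \<and> bruhat_cover w k b' \<longleftrightarrow> b' = b" for b' using only cover b(1) by blast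
    have "(a, b') \<in> monk_covers k w \<longleftrightarrow> (a, b') \<in> insert (k, b) (monk_covers (k - 1) w)" for a b'
      unfolding below using k at_k[of b'] by (cases "a = k") (auto simp: monk_covers_def)
    then show ?thesis by auto
  qed
  moreover have "(k, b) \<notin> monk_covers (k - 1) w" using k by (auto simp: monk_covers_def)
  moreover have "swap_positions w (k, b) = u" by (simp add: w_def)
  ultimately have "var_sum k * schubert w = schubert u + var_sum (k - 1) * schubert w"
    by (simp add: monk_formula[OF w] finite_monk_covers[OF w])
  moreover have "var_sum k = var_sum (k - 1) + X k" using k by (cases k) (auto simp: var_sum_Suc)
  ultimately show "schubert u = X k * schubert w" by (simp add: distrib_right)
qed

text \<open>Lower the last of the decreasing entries step by step to \<open>1\<close>; after that it belongs to the increasing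
  part of \<open>u\<close> and \<open>k\<close> can be replaced by \<open>k - 1\<close>.\<close>

lemma schubert_descending:
  assumes "is_perm u" "\<And>i j. 1 \<le> i \<Longrightarrow> i < j \<Longrightarrow> j \<le> k \<Longrightarrow> u j < u i" "ascends_after k u"
  shows "schubert u = (\<Prod>i=1..k. X i ^ (u i - 1))"
  using assms
proof (induction k arbitrary: u)
  case 0
  have "u = id" by (rule perm_without_descents) (use 0 in \<open>auto simp: ascends_after_def\<close>)
  then have "schubert u = 1" using schubert_id by metis
  then show ?case by simp
next
  case (Suc k)
  note IH_k = Suc.IH
  show ?case using Suc.prems
  proof (induction "u (Suc k)" arbitrary: u rule: less_induct)
    case (less u)
    note u = less.prems(1) and dec = less.prems(2) and after = less.prems(3)
    have "1 \<le> u (Suc k)" by (rule is_perm_pos[OF u]) simp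
    show ?case
    proof (cases "u (Suc k) = 1")
      case True
      have "ascends_after k u" unfolding ascends_after_def
      proof (intro allI impI)
        fix i assume "k < i"
        show "u i < u (Suc i)"
        proof (cases "i = Suc k")
          case True
          have "u (Suc i) \<noteq> u i" using is_perm_eq_iff[OF u] by simp
          moreover have "1 \<le> u (Suc i)" by (rule is_perm_pos[OF u]) simp
          ultimately show ?thesis using True \<open>u (Suc k) = 1\<close> by simp
        next
          case False
          then show ?thesis using after \<open>k < i\<close> by (simp add: ascends_after_def)
        qed
      qed
      then have "schubert u = (\<Prod>i=1..k. X i ^ (u i - 1))" using IH_k[OF u] dec by simp
      then show ?thesis using True by simp
    next
      case False
      have "bij u" using u by (auto simp: is_perm_def permutes_bij)
      then obtain b where "u b = u (Suc k) - 1" by (metis bij_pointE)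
      then have b: "Suc (u b) = u (Suc k)" "u b \<noteq> 0" using False \<open>1 \<le> u (Suc k)\<close> by auto
      have "b \<noteq> 0" using b(2) u by (metis is_perm_zero)
      moreover have "\<not> b < Suc k" using dec[of b "Suc k"] b \<open>b \<noteq> 0\<close> by force
      moreover have "b \<noteq> Suc k" using b(1) by auto
      ultimately have "Suc k < b" by simp
      define w where "w = swap_positions u (Suc k, b)"
      have step: "schubert u = X (Suc k) * schubert w" "is_perm w" "ascends_after (Suc k) w"
        unfolding w_def
        using schubert_lower_last_descending[OF u _ _ after \<open>Suc k < b\<close> b(1)] dec by auto
      have w_k: "Suc (w (Suc k)) = u (Suc k)" using b by (simp add: w_def)
      have w_low: "w i = u i" if "i \<le> k" for i using that \<open>Suc k < b\<close> by (simp add: w_def transpose_apply_other)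
      have "schubert w = (\<Prod>i=1..Suc k. X i ^ (w i - 1))"
      proof (rule less.hyps)
        show "w (Suc k) < u (Suc k)" using w_k by simp
        show "w j < w i" if ij: "1 \<le> i" "i < j" "j \<le> Suc k" for i j
          using dec[OF ij] w_k w_low[of i] w_low[of j] ij by (cases "j = Suc k") auto
      qed (use step in auto)
      moreover have "(\<Prod>i=1..k. X i ^ (w i - 1)) = (\<Prod>i=1..k. X i ^ (u i - 1))"
        by (rule prod.cong) (auto simp: w_low)
      moreover have "u (Suc k) - 1 = Suc (w (Suc k) - 1)"
        using w_k is_perm_pos[OF step(2), of "Suc k"] by simp
      ultimately show ?thesis unfolding step(1) by simp
    qed
  qed
qed

definition grassmannian_at :: "nat \<Rightarrow> (nat \<Rightarrow> nat) \<Rightarrow> bool" where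
  "grassmannian_at k v \<longleftrightarrow> (\<forall>i\<ge>1. i \<noteq> k \<longrightarrow> v i < v (Suc i))"

text \<open>Induction on \<open>\<Sum>i\<le>k. i * u i\<close>, which decreases when an ascent among the first \<open>k\<close> entries is turned
  into a descent.\<close>

lemma schubert_positive_product:
  assumes "is_perm u" "ascends_after k u" and v: "is_perm v" "grassmannian_at k v"
  shows "schubert_positive (schubert u * schubert v)"
  using assms(1,2)
proof (induction "\<Sum>i=1..k. i * u i" arbitrary: u rule: less_induct)
  case less
  note u = less.prems(1) and after = less.prems(2)
  show ?case
  proof (cases "\<exists>i. 1 \<le> i \<and> i < k \<and> u i < u (Suc i)")
    case True
    then obtain i where i: "1 \<le> i" "i < k" "u i < u (Suc i)" by blast
    define w where "w = swap_adjacent u i"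
    have w: "is_perm w" unfolding w_def by (rule is_perm_swap_positions) (use u i in auto)
    have w_after: "ascends_after k w"
      using after i by (auto simp: w_def ascends_after_def transpose_apply_other)
    have split: "(\<Sum>j=1..k. j * g j) = (\<Sum>j\<in>{1..k} - {i, Suc i}. j * g j) + (i * g i + Suc i * g (Suc i))" for g
    proof -
      have "{1..k} = ({1..k} - {i, Suc i}) \<union> {i, Suc i}" using i by auto
      then have "(\<Sum>j=1..k. j * g j) = (\<Sum>j\<in>({1..k} - {i, Suc i}) \<union> {i, Suc i}. j * g j)" by simp
      also have "\<dots> = (\<Sum>j\<in>{1..k} - {i, Suc i}. j * g j) + (\<Sum>j\<in>{i, Suc i}. j * g j)"
        by (rule sum.union_disjoint) auto
      finally show ?thesis by simp
    qed
    have "(\<Sum>j\<in>{1..k} - {i, Suc i}. j * w j) = (\<Sum>j\<in>{1..k} - {i, Suc i}. j * u j)"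
      by (rule sum.cong) (auto simp: w_def transpose_apply_other)
    then have "(\<Sum>j=1..k. j * w j) < (\<Sum>j=1..k. j * u j)"
      unfolding split using i(3) by (simp add: w_def)
    then have IH: "schubert_positive (schubert w * schubert v)"
      using less.hyps w w_after by blast
    have "ddiff i (schubert v) = 0"
      using ddiff_schubert[OF v(1) i(1)] v(2) i by (auto simp: grassmannian_at_def dest: less_asym)
    moreover have "ddiff i (schubert w) = schubert u"
      using ddiff_schubert[OF w i(1)] i(3) by (simp add: w_def)
    ultimately have "schubert u * schubert v = ddiff i (schubert w * schubert v)"
      by (simp add: ddiff_mult)
    then show ?thesis using schubert_positive_ddiff[OF IH i(1)] by simp
  next
    case False
    then have step: "u (Suc i) < u i" if "1 \<le> i" "i < k" for i
      using that is_perm_eq_iff[OF u, of i "Suc i"] by (metis linorder_neqE_nat n_not_Suc_n)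
    have dec: "u j < u i" if "1 \<le> i" "i < j" "j \<le> k" for i j
      using that(2,1,3)
    proof (induction j)
      case (Suc j)
      then show ?case using step[of j] by (cases "i = j") auto
    qed simp
    have monomial: "schubert u = (\<Prod>i=1..k. X i ^ (u i - 1))"
      by (rule schubert_descending[OF u _ after]) (use dec in blast)
    show ?thesis unfolding monomial
    proof (rule schubert_positive_dominant_monomial[OF schubert_positive_schubert[OF v(1)]])
      show "u j - 1 \<le> u i - 1" if "1 \<le> i" "i \<le> j" "j \<le> k" for i j
        using dec[of i j] that by (cases "i = j") auto
    qed
  qed
qed

section \<open>Counting paths of covers\<close>

fun cover_paths :: "nat \<Rightarrow> nat \<Rightarrow> (nat \<Rightarrow> nat) \<Rightarrow> (nat \<times> nat) list set" where
  "cover_paths k 0 u = {[]}"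
| "cover_paths k (Suc n) u =
     (\<lambda>(p, ps). p # ps) ` (SIGMA p : monk_covers k u. cover_paths k n (swap_positions u p))"

lemma apply_path_Cons: "apply_path u (p # ps) = apply_path (swap_positions u p) ps"
  by (simp add: apply_path_def)

lemma is_perm_monk_cover': "is_perm u \<Longrightarrow> p \<in> monk_covers k u \<Longrightarrow> is_perm (swap_positions u p)"
  by (cases p) (simp add: is_perm_monk_cover)

lemma cover_paths_paths:
  assumes "is_perm u" "ps \<in> cover_paths k n u"
  shows "ps \<in> paths k n u (apply_path u ps) \<and> is_perm (apply_path u ps)"
  using assms
proof (induction n arbitrary: u ps)
  case 0
  then show ?case by (simp add: paths_def apply_path_def)
next
  case (Suc n)
  then obtain a b qs where ps: "ps = (a, b) # qs" and ab: "(a, b) \<in> monk_covers k u"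
    and qs: "qs \<in> cover_paths k n (swap_positions u (a, b))" by auto
  have "perm_length (swap_positions u (a, b)) = Suc (perm_length u)"
    by (rule perm_length_cover[OF Suc.prems(1)]) (use ab in \<open>auto simp: monk_covers_def\<close>)
  then show ?case
    using Suc.IH[OF is_perm_monk_cover[OF Suc.prems(1) ab] qs] ab
    by (auto simp: ps apply_path_Cons paths_def monk_covers_def simp del: swap_positions_apply)
qed

lemma finite_cover_paths: "is_perm u \<Longrightarrow> finite (cover_paths k n u)"
  by (induction n arbitrary: u)
     (auto intro!: finite_imageI finite_SigmaI finite_monk_covers is_perm_monk_cover')

lemma var_sum_power_schubert:
  assumes "is_perm u"
  shows "var_sum k ^ n * schubert u = (\<Sum>ps\<in>cover_paths k n u. schubert (apply_path u ps))"
  using assms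
proof (induction n arbitrary: u)
  case 0
  then show ?case by (simp add: apply_path_def)
next
  case (Suc n)
  have "var_sum k ^ Suc n * schubert u = var_sum k ^ n * (var_sum k * schubert u)"
    by (simp add: mult.assoc mult.left_commute)
  also have "\<dots> = (\<Sum>p\<in>monk_covers k u. var_sum k ^ n * schubert (swap_positions u p))"
    by (simp add: monk_formula[OF Suc.prems] sum_distrib_left case_prod_unfold)
  also have "\<dots> = (\<Sum>p\<in>monk_covers k u. \<Sum>ps\<in>cover_paths k n (swap_positions u p). schubert (apply_path (swap_positions u p) ps))"
    by (rule sum.cong[OF refl]) (simp add: Suc is_perm_monk_cover')
  also have "\<dots> = (\<Sum>(p, ps)\<in>(SIGMA p : monk_covers k u. cover_paths k n (swap_positions u p)). schubert (apply_path u (p # ps)))"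
    unfolding apply_path_Cons
    by (rule sum.Sigma) (use Suc.prems in \<open>auto simp: finite_monk_covers intro!: finite_cover_paths is_perm_monk_cover\<close>)
  also have "\<dots> = (\<Sum>ps\<in>cover_paths k (Suc n) u. schubert (apply_path u ps))"
    by (simp add: sum.reindex inj_on_def case_prod_unfold)
  finally show ?case .
qed

lemma expansion_var_sum_power:
  assumes "is_perm u"
  shows "expansion (var_sum k ^ n * schubert u) (\<lambda>w. int (card {ps \<in> cover_paths k n u. apply_path u ps = w}))"
proof -
  have "expansion (var_sum k ^ n * schubert u)
      (\<lambda>w. \<Sum>ps\<in>cover_paths k n u. if w = apply_path u ps then 1 else 0)"
    unfolding var_sum_power_schubert[OF assms]
    by (rule expansion_sum) (use cover_paths_paths[OF assms] expansion_schubert in blast)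
  moreover have "(\<Sum>ps\<in>cover_paths k n u. if w = apply_path u ps then 1 else 0)
      = int (card {ps \<in> cover_paths k n u. apply_path u ps = w})" for w
  proof -
    have "(\<Sum>ps\<in>cover_paths k n u. if w = apply_path u ps then (1 :: int) else 0)
        = (\<Sum>ps\<in>{ps \<in> cover_paths k n u. apply_path u ps = w}. 1)"
      by (rule sum.mono_neutral_cong_right) (auto simp: finite_cover_paths[OF assms])
    then show ?thesis by simp
  qed
  ultimately show ?thesis by simp
qed

lemma grassmannian_at_cover:
  assumes "is_perm v" "grassmannian_at k v" "(a, b) \<in> monk_covers k v"
  shows "grassmannian_at k (swap_positions v (a, b))"
  unfolding grassmannian_at_def
proof (intro allI impI)
  fix i :: nat assume i: "1 \<le> i" "i \<noteq> k"
  have "bruhat_cover v a b" "a < b" "(a, b) \<noteq> (i, Suc i)"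
    using assms(3) i by (auto simp: monk_covers_def bruhat_cover_def)
  then show "swap_positions v (a, b) i < swap_positions v (a, b) (Suc i)"
    using bruhat_cover_lift[OF assms(1), of i a b] assms(2) i by (auto simp: grassmannian_at_def)
qed

text \<open>Let \<open>a\<close> be the first position with \<open>v a \<noteq> a\<close>. Then \<open>v a - 1\<close> is a value of \<open>v\<close> after position \<open>k\<close>, and
  exchanging the two neighbouring values keeps the order of all other pairs.\<close>

lemma grassmannian_at_lower:
  assumes v: "is_perm v" "grassmannian_at k v" "v \<noteq> id"
  obtains w a b where "is_perm w" "grassmannian_at k w" "(a, b) \<in> monk_covers k w" "v = swap_positions w (a, b)"
proof -
  note inj = is_perm_eq_iff[OF v(1)]
  have asc: "v i < v (Suc i)" if "1 \<le> i" "i \<noteq> k" for i using v(2) that by (simp add: grassmannian_at_def)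
  have incr: "v i < v j" if "1 \<le> i" "i < j" "j \<le> k" for i j
    using that(2,1,3)
  proof (induction j)
    case (Suc j)
    then show ?case using asc[of j] by (cases "i = j") auto
  qed simp
  obtain i where i: "1 \<le> i" "v (Suc i) < v i" using perm_descent_exists[OF v(1,3)] by blast
  then have "i = k" using asc[of i] by fastforce
  then have k: "1 \<le> k" "v (Suc k) < v k" using i by auto
  define a where "a = (LEAST a. v a \<noteq> a)"
  have "\<exists>a. v a \<noteq> a" using v(3) by (auto simp: fun_eq_iff)
  then have "v a \<noteq> a" unfolding a_def by (rule LeastI_ex)
  have fixed: "v i = i" if "i < a" for i using not_less_Least[OF that[unfolded a_def]] by blast
  have "1 \<le> a" using \<open>v a \<noteq> a\<close> v(1) by (metis is_perm_zero less_one linorder_not_less)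
  have "a \<le> k"
  proof (rule ccontr)
    assume "\<not> a \<le> k"
    then have "v k = k" "v (v (Suc k)) = v (Suc k)" using fixed k by auto
    then show False using inj k by simp
  qed
  have "a < v a"
  proof (rule ccontr)
    assume "\<not> a < v a"
    then have "v (v a) = v a" using fixed \<open>v a \<noteq> a\<close> by simp
    then show False using inj \<open>v a \<noteq> a\<close> by simp
  qed
  have "bij v" using v(1) by (auto simp: is_perm_def permutes_bij)
  then obtain b where "v b = v a - 1" by (metis bij_pointE)
  then have b: "Suc (v b) = v a" using \<open>a < v a\<close> by simp
  have "\<not> b < a" using fixed[of b] b \<open>a < v a\<close> by auto
  moreover have "b \<noteq> a" using b by auto
  moreover have "\<not> (a < b \<and> b \<le> k)" using incr[of a b] b \<open>1 \<le> a\<close> by auto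
  ultimately have "k < b" using \<open>a \<le> k\<close> by simp
  define w where "w = swap_positions v (a, b)"
  have w: "is_perm w" unfolding w_def by (rule is_perm_swap_positions) (use v(1) \<open>1 \<le> a\<close> \<open>k < b\<close> in auto)
  have w_a: "w a = v b" and w_b: "w b = v a" and w_other: "\<And>i. i \<noteq> a \<Longrightarrow> i \<noteq> b \<Longrightarrow> w i = v i"
    by (auto simp: w_def transpose_apply_other)
  have "grassmannian_at k w"
    unfolding grassmannian_at_def
  proof (intro allI impI)
    fix i :: nat assume i: "1 \<le> i" "i \<noteq> k"
    have ne: "v i = v a \<longleftrightarrow> i = a" "v (Suc i) = v a \<longleftrightarrow> Suc i = a" "v i = v b \<longleftrightarrow> i = b" "v (Suc i) = v b \<longleftrightarrow> Suc i = b"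
      by (simp_all add: inj)
    have "\<not> (i = a \<and> Suc i = b)" "\<not> (i = b \<and> Suc i = a)" using i \<open>a \<le> k\<close> \<open>k < b\<close> by auto
    then show "w i < w (Suc i)"
      using asc[OF i] ne b w_a w_b w_other[of i] w_other[of "Suc i"]
      by (cases "i = a"; cases "i = b"; cases "Suc i = a"; cases "Suc i = b") auto
  qed
  moreover have "(a, b) \<in> monk_covers k w"
    using \<open>1 \<le> a\<close> \<open>a \<le> k\<close> \<open>k < b\<close> b by (auto simp: monk_covers_def bruhat_cover_def w_a w_b)
  moreover have "v = swap_positions w (a, b)" by (simp add: w_def)
  ultimately show ?thesis using that w by blast
qed

text \<open>Pass from \<open>w\<close> to the cover \<open>v\<close>: the new difference is \<open>var_sum k\<close> times the old one plus the product of \<open>S u\<close>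
  with the remaining terms of Monk's formula for \<open>w\<close>, all of which are Grassmannian at \<open>k\<close>.\<close>

lemma schubert_positive_power_minus_product:
  assumes u: "is_perm u" "ascends_after k u" and "is_perm v" "grassmannian_at k v"
  shows "schubert_positive (var_sum k ^ perm_length v * schubert u - schubert u * schubert v)"
  using assms(3,4)
proof (induction "perm_length v" arbitrary: v rule: less_induct)
  case less
  show ?case
  proof (cases "v = id")
    case True
    then show ?thesis by (simp add: schubert_id schubert_positive_zero)
  next
    case False
    then obtain w a b where w: "is_perm w" "grassmannian_at k w" and ab: "(a, b) \<in> monk_covers k w"
      and v: "v = swap_positions w (a, b)" using grassmannian_at_lower less.prems by metis
    have len: "perm_length v = Suc (perm_length w)"
      unfolding v by (rule perm_length_cover[OF w(1)]) (use ab in \<open>auto simp: monk_covers_def\<close>)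
    let ?rest = "\<Sum>p\<in>monk_covers k w - {(a, b)}. schubert u * schubert (swap_positions w p)"
    have "var_sum k * schubert w = schubert v + (\<Sum>p\<in>monk_covers k w - {(a, b)}. schubert (swap_positions w p))"
      using sum.remove[OF finite_monk_covers[OF w(1)] ab, of "\<lambda>p. schubert (swap_positions w p)"]
      by (simp add: monk_formula[OF w(1)] case_prod_unfold v)
    then have "var_sum k * (schubert u * schubert w) = schubert u * schubert v + ?rest"
      by (simp add: mult.left_commute[of "var_sum k"] distrib_left sum_distrib_left)
    then have eq: "var_sum k ^ perm_length v * schubert u - schubert u * schubert v
        = var_sum k * (var_sum k ^ perm_length w * schubert u - schubert u * schubert w) + ?rest"
      by (simp add: len right_diff_distrib mult.assoc)
    have "schubert_positive ?rest"
    proof (rule schubert_positive_sum)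
      fix p assume p: "p \<in> monk_covers k w - {(a, b)}"
      obtain c d where cd: "p = (c, d)" by fastforce
      show "schubert_positive (schubert u * schubert (swap_positions w p))"
        unfolding cd by (rule schubert_positive_product[OF u])
          (use p cd w grassmannian_at_cover is_perm_monk_cover in blast)+
    qed
    moreover have "schubert_positive (var_sum k ^ perm_length w * schubert u - schubert u * schubert w)"
      using less.hyps[of w] w len by simp
    ultimately show ?thesis unfolding eq by (intro schubert_positive_add schubert_positive_var_sum)
  qed
qed

section \<open>The Grassmannian permutation of a partition\<close>

lemma part_antimono:
  assumes "is_partition lam" "1 \<le> i" "i \<le> j" shows "part lam j \<le> part lam i"
proof (cases "j \<le> length lam \<and> i \<noteq> j")
  case True
  then have "lam ! (j - 1) \<le> lam ! (i - 1)"
    using assms by (intro sorted_wrt_nth_less[of "(\<ge>)"]) (auto simp: is_partition_def)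
  then show ?thesis using True assms by (simp add: part_def)
qed (use assms in \<open>auto simp: part_def\<close>)

text \<open>The values at the first \<open>k\<close> positions form the increasing sequence \<open>h\<close>, the others enumerate the complement of its
  image. An entry \<open>v i\<close> with \<open>i \<le> k\<close> is larger than exactly \<open>v i - i\<close> entries to the right of \<open>k\<close>, and \<open>v i - i\<close> is the
  corresponding part of the partition. Far to the right every entry exceeds all of \<open>h\<close>, hence everything before it, and is a
  fixed point.\<close>

lemma grassmannian_properties:
  assumes lam: "is_partition lam" "length lam \<le> k"
  shows "is_perm (grassmannian lam k)" and "grassmannian_at k (grassmannian lam k)"
    and "perm_length (grassmannian lam k) = sum_list lam"
proof -
  let ?v = "grassmannian lam k"
  define h where "h j = j + part lam (k - j + 1)" for j
  define T where "T = h ` {1..k}"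
  define C where "C = {1..} - T"
  have h_mono: "h i < h j" if "i < j" "j \<le> k" for i j
    using part_antimono[OF lam(1), of "k - j + 1" "k - i + 1"] that
    by (simp add: h_def add_less_le_mono diff_le_mono2)
  have v0: "?v 0 = 0" by (simp add: grassmannian_def)
  have v_low: "?v i = h i" if "i \<in> {1..k}" for i using that by (simp add: grassmannian_def h_def)
  have v_high: "?v i = enumerate C (i - k - 1)" if "k < i" for i
  proof -
    have "C = {1..} - (\<lambda>j. j + part lam (k - j + 1)) ` {1..k}"
      unfolding C_def T_def h_def ..
    then show ?thesis using that by (simp add: grassmannian_def)
  qed
  have finT: "finite T" by (simp add: T_def)
  have infC: "infinite C" unfolding C_def using finT by (simp add: infinite_Ici Diff_infinite_finite)
  have T_pos: "T \<subseteq> {1..}" by (auto simp: T_def h_def)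
  have inj_h: "inj_on h {1..k}"
    by (rule inj_onI) (metis atLeastAtMost_iff h_mono less_irrefl linorder_neqE_nat)
  have bij_low: "bij_betw ?v {1..k} T"
    unfolding T_def by (rule bij_betw_cong[THEN iffD1, OF _ inj_on_imp_bij_betw[OF inj_h]]) (simp add: v_low)
  have bij_high: "bij_betw ?v {k<..} C"
  proof -
    have "bij_betw (\<lambda>i. i - k - 1) {k<..} (UNIV :: nat set)"
      by (rule bij_betw_byWitness[where f' = "\<lambda>n. n + k + 1"]) auto
    then have "bij_betw (enumerate C \<circ> (\<lambda>i. i - k - 1)) {k<..} C"
      by (rule bij_betw_trans) (rule bij_enumerate[OF infC])
    then show ?thesis by (rule bij_betw_cong[THEN iffD1, rotated]) (simp add: v_high)
  qed
  have bij: "bij_betw ?v {1..} {1..}"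
  proof -
    have "{1..k} \<union> {k<..} = {1..}" "T \<union> C = {1..}" "T \<inter> C = {}" using T_pos by (auto simp: C_def)
    then show ?thesis using bij_betw_combine[OF bij_low bij_high] by simp
  qed
  have perm: "?v permutes {1..}"
    by (rule bij_imp_permutes[OF bij]) (metis v0 atLeast_iff less_one linorder_not_less)
  have asc_high: "?v i < ?v j" if "k < i" "i < j" for i j
    using that by (simp add: v_high infC)
  have asc_low: "?v i < ?v j" if "1 \<le> i" "i < j" "j \<le> k" for i j
    using that by (simp add: v_low h_mono)
  show gr: "grassmannian_at k ?v"
    unfolding grassmannian_at_def
  proof (intro allI impI)
    fix i :: nat assume "1 \<le> i" "i \<noteq> k"
    then show "?v i < ?v (Suc i)" using asc_high[of i "Suc i"] asc_low[of i "Suc i"] by (cases "i < k") auto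
  qed
  have fixed: "?v j = j" if j: "Max (insert 0 T) + k + 1 < j" for j
  proof -
    have "j - k - 1 \<le> enumerate C (j - k - 1)" by (rule le_enumerate[OF infC])
    then have big: "Max (insert 0 T) < ?v j" using j v_high[of j] by simp
    have T_less: "t < ?v j" if "t \<in> T" for t
      using Max_ge[of "insert 0 T" t] that finT big by simp
    have order: "i < j \<longleftrightarrow> ?v i < ?v j" if "1 \<le> i" for i
    proof (cases "i \<le> k")
      case True
      then have "?v i \<in> T" using bij_low that by (auto simp: bij_betw_def)
      then show ?thesis using T_less True j by simp
    next
      case False
      then show ?thesis using asc_high[of i j] asc_high[of j i] j by (cases i j rule: linorder_cases) auto
    qed
    have im: "?v ` {1..} = {1..}" and inj: "inj_on ?v {1..}" using bij by (auto simp: bij_betw_def)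
    have "?v ` {1..<j} = {1..<?v j}"
    proof (intro equalityI subsetI)
      fix y assume "y \<in> ?v ` {1..<j}"
      then obtain i where i: "1 \<le> i" "i < j" "y = ?v i" by auto
      then have "y \<in> {1..}" using im by (metis atLeast_iff imageI)
      then show "y \<in> {1..<?v j}" using order i by simp
    next
      fix y assume y: "y \<in> {1..<?v j}"
      then have "y \<in> ?v ` {1..}" unfolding im by simp
      then obtain i where "1 \<le> i" "y = ?v i" by auto
      then show "y \<in> ?v ` {1..<j}" using order[of i] y by auto
    qed
    moreover have "inj_on ?v {1..<j}" by (rule inj_on_subset[OF inj]) auto
    ultimately have "card {1..<?v j} = card {1..<j}" using card_image by metis
    moreover have "?v j \<in> {1..}" using im j by (metis atLeast_iff imageI le_add2 less_imp_le_nat order_trans)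
    ultimately show ?thesis using j by simp
  qed
  show pm: "is_perm ?v"
    unfolding is_perm_def
  proof (intro conjI perm)
    have "{i. ?v i \<noteq> i} \<subseteq> {..Max (insert 0 T) + k + 1}"
    proof
      fix i assume "i \<in> {i. ?v i \<noteq> i}"
      then have "\<not> Max (insert 0 T) + k + 1 < i" using fixed[of i] by blast
      then show "i \<in> {..Max (insert 0 T) + k + 1}" by simp
    qed
    then show "finite {i. ?v i \<noteq> i}" by (rule finite_subset) simp
  qed
  have inv: "inversions ?v = (SIGMA i : {1..k}. {j. k < j \<and> ?v j < ?v i})"
  proof (intro equalityI subsetI)
    fix p assume "p \<in> inversions ?v"
    then obtain i j where ij: "p = (i, j)" "1 \<le> i" "i < j" "?v j < ?v i" by (auto simp: inversions_def)
    have "i \<le> k" using asc_high[of i j] ij by (cases "i \<le> k") auto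
    moreover have "k < j" using asc_low[of i j] ij by (cases "k < j") auto
    ultimately show "p \<in> (SIGMA i : {1..k}. {j. k < j \<and> ?v j < ?v i})" using ij by simp
  qed (auto simp: inversions_def)
  have "finite {j. k < j \<and> ?v j < ?v i}" if "i \<in> {1..k}" for i
    by (rule finite_subset[of _ "snd ` inversions ?v"])
       (use that inv finite_inversions[OF pm] in \<open>force+\<close>)
  moreover have "card {j. k < j \<and> ?v j < ?v i} = part lam (k - i + 1)" if i: "i \<in> {1..k}" for i
  proof -
    have "?v ` {j. k < j \<and> ?v j < ?v i} = {1..<h i} - h ` {1..<i}"
    proof (intro equalityI subsetI)
      fix y assume "y \<in> ?v ` {j. k < j \<and> ?v j < ?v i}"
      then obtain j where j: "y = ?v j" "k < j" "?v j < ?v i" by blast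
      then have "y \<in> C" using bij_high by (auto simp: bij_betw_def)
      then show "y \<in> {1..<h i} - h ` {1..<i}" using j i v_low[OF i] by (auto simp: C_def T_def)
    next
      fix y assume y: "y \<in> {1..<h i} - h ` {1..<i}"
      have "y \<notin> T"
      proof
        assume "y \<in> T"
        then obtain j where "j \<in> {1..k}" "y = h j" by (auto simp: T_def)
        then show False using y h_mono[of i j] i by (cases "j < i"; cases "j = i") auto
      qed
      then have "y \<in> C" using y by (simp add: C_def)
      then obtain j where "k < j" "y = ?v j" using bij_high by (auto simp: bij_betw_def)
      then show "y \<in> ?v ` {j. k < j \<and> ?v j < ?v i}" using y v_low[OF i] by auto
    qed
    moreover have "inj_on ?v {j. k < j \<and> ?v j < ?v i}"
      using bij_high by (auto simp: bij_betw_def intro: inj_on_subset)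
    ultimately have "card {j. k < j \<and> ?v j < ?v i} = card ({1..<h i} - h ` {1..<i})"
      by (metis card_image)
    also have "\<dots> = card {1..<h i} - card (h ` {1..<i})"
    proof (rule card_Diff_subset)
      show "h ` {1..<i} \<subseteq> {1..<h i}"
      proof
        fix y assume "y \<in> h ` {1..<i}"
        then obtain j where "1 \<le> j" "j < i" "y = h j" by auto
        then show "y \<in> {1..<h i}" using h_mono[of j i] i by (simp add: h_def)
      qed
    qed simp
    also have "card (h ` {1..<i}) = i - 1"
    proof -
      have "inj_on h {1..<i}" by (rule inj_on_subset[OF inj_h]) (use i in auto)
      then show ?thesis by (simp add: card_image)
    qed
    finally show ?thesis using i by (simp add: h_def)
  qed
  ultimately have "perm_length ?v = (\<Sum>i=1..k. part lam (k - i + 1))"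
    by (simp add: perm_length_inversions inv card_SigmaI)
  also have "\<dots> = (\<Sum>i=1..k. part lam i)"
    by (rule sum.reindex_bij_witness[where i = "\<lambda>i. k - i + 1" and j = "\<lambda>i. k - i + 1"]) auto
  also have "\<dots> = (\<Sum>i=1..length lam. part lam i)"
    by (rule sum.mono_neutral_right) (use lam in \<open>auto simp: part_def\<close>)
  also have "\<dots> = (\<Sum>i<length lam. lam ! i)"
    by (rule sum.reindex_bij_witness[where i = Suc and j = "\<lambda>i. i - 1"]) (auto simp: part_def)
  also have "\<dots> = sum_list lam" by (simp add: sum_list_sum_nth atLeast0LessThan)
  finally show "perm_length ?v = sum_list lam" .
qed

section \<open>The coefficients as numbers of paths\<close>

theorem corollary4p5:
  fixes u w :: "nat \<Rightarrow> nat" and k n :: nat and lam :: "nat list"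
  assumes "is_perm u"
    and "k \<ge> 1"
    and "\<forall>i>k. u i < u (i + 1)"
    and "is_partition lam"
    and "length lam \<le> k"
    and "n = sum_list lam"
    and "is_perm w"
  shows "\<exists>S. S \<subseteq> paths k n u w \<and> finite S \<and>
           schubert_coeff u (grassmannian lam k) w = int (card S)"
proof -
  let ?v = "grassmannian lam k"
  let ?P = "{ps \<in> cover_paths k n u. apply_path u ps = w}"
  have v: "is_perm ?v" "grassmannian_at k ?v" "perm_length ?v = n"
    using grassmannian_properties[OF assms(4,5)] assms(6) by auto
  have u: "is_perm u" "ascends_after k u" using assms by (auto simp: ascends_after_def)
  have pos: "schubert_positive (schubert u * schubert ?v)"
    by (rule schubert_positive_product[OF u v(1,2)])
  then obtain c where c: "expansion (schubert u * schubert ?v) c" "0 \<le> c w"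
    by (auto simp: schubert_positive_def)
  have "0 \<le> int (card ?P) - c w"
    using schubert_positive_coeff[OF schubert_positive_power_minus_product[OF u v(1,2)]
        expansion_diff[OF expansion_var_sum_power[OF u(1)] c(1)], of w] by (simp add: v(3))
  then have "nat (c w) \<le> card ?P" by simp
  then obtain S where S: "S \<subseteq> ?P" "card S = nat (c w)" "finite S" by (rule obtain_subset_with_card_n)
  have "S \<subseteq> paths k n u w" using S(1) cover_paths_paths[OF u(1)] by blast
  then show ?thesis using S(2,3) c schubert_coeff_eq[OF c(1)] by auto
qed

end
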